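(* Let $(M,\circ,g,e)$ be a (pseudo-)Riemannian F-manifold with Killing unit vector field and let $\nabla$ be its associated flat connection. Let $\overline X$ be a Legendre vector field (with respect to $\nabla$) that is flat, i.e. $\nabla\overline X=0$. Then $(M,\circ,\overline g,e)$, where $$\overline g(Y,Z):=g(\overline X\circ Y,\overline X\circ Z)$$ for all vector fields $Y,Z$, is a (pseudo-)Riemannian F-manifold with Killing unit vector field, and its associated flat connection is $$\overline\nabla_Y Z:=\overline X^{-1}\circ\nabla_Y(\overline X\circ Z).$$
   Context: $M$ is a smooth manifold; "vector field" means smooth local vector field; metrics are pseudo-Riemannian (nondegenerate, symmetric). $d\theta(X,Y)=X(\theta(Y))-Y(\theta(X))-\theta([X,Y])$. The Riemann tensor of a connection $\nabla$ is $R(X,Y)Z=\nabla_X\nabla_YZ-\nabla_Y\nabla_XZ-\nabla_{[X,Y]}Z$. F-manifold: a triple $(M,\circ,e)$ where $\circ$ is a commutative associative $C^\infty$-bilinear product on vector fields such that $\mathcal L_{X\circ Y}(\circ)=X\circ\mathcal L_Y(\circ)+Y\circ\mathcal L_X(\circ)$ for all vector fields $X,Y$ ($\circ$ viewed as a $(1,2)$ tensor, $\mathcal L$ the Lie derivative), and $e$ is a vector field with $e\circ X=X$ for all $X$. (Pseudo-)Riemannian F-manifold with Killing unit vector field: an F-manifold $(M,\circ,e)$ with a (pseudo-)Riemannian metric $g$ such that (i) $g(X\circ Y,Z)=g(X,Y\circ Z)$; (ii) the Riemann tensor $R$ of $g$ satisfies $R(Y,Z)(X\circ W)+R(X,Y)(Z\circ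 W)+R(Z,X)(Y\circ W)=0$ for all vector fields $X,Y,Z,W$; (iii) $\mathcal L_e g=0$. Associated flat connection: for such $(M,\circ,g,e)$, with $\theta(X):=g(e,X)$, it is the unique torsionless connection $\nabla$ satisfying $(\nabla_X g)(Y,Z)=\frac12 d\theta(X\circ Y,Z)+\frac12 d\theta(X\circ Z,Y)$ for all vector fields $X,Y,Z$. It is a known fact that it exists and that $(M,\circ,\nabla,e)$ is a flat F-manifold: $\nabla$ is flat, $\nabla e=0$, and $(\nabla_X c)(Y,Z)$ is symmetric in $X,Y,Z$, where $c(X,Y)=X\circ Y$. A vector field $\overline X$ is invertible if there is a vector field $\overline X^{-1}$ with $\overline X\circ \overline X^{-1}=e$. A Legendre vector field is an invertible vector field $\overline X$ satisfying $c^i_{jl}\nabla_k\overline X^l=c^i_{kl}\nabla_j\overline X^l$ in local coordinates, where $c^i_{jk}$ are the structure constants of $\circ$; equivalently $Y\circ\nabla_Z\overline X=Z\circ\nabla_Y\overline X$ for all vector fields $Y,Z$. *)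

theory Defs
  imports "HOL-Analysis.Analysis"
begin

section \<open>Smooth manifolds\<close>

text \<open>\<^term>\<open>Ck_on k S f\<close> is meant for open sets \<^term>\<open>S\<close>: \<^term>\<open>f\<close> is \<^term>\<open>k\<close> times
  continuously differentiable on \<^term>\<open>S\<close>.\<close>

primrec Ck_on :: "nat \<Rightarrow> 'e::euclidean_space set \<Rightarrow> ('e \<Rightarrow> 'f::real_normed_vector) \<Rightarrow> bool" where
  "Ck_on 0 S f \<longleftrightarrow> continuous_on S f"
| "Ck_on (Suc k) S f \<longleftrightarrow>
     (\<forall>x\<in>S. f differentiable (at x)) \<and> (\<forall>v. Ck_on k S (\<lambda>x. frechet_derivative f (at x) v))"

definition smooth_on :: "'e::euclidean_space set \<Rightarrow> ('e \<Rightarrow> 'f::real_normed_vector) \<Rightarrow> bool" where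
  "smooth_on S f \<longleftrightarrow> (\<forall>k. Ck_on k S f)"

text \<open>A chart is a pair \<^term>\<open>(U, \<phi>)\<close> of a domain and a coordinate map (only the values of
  \<^term>\<open>\<phi>\<close> on \<^term>\<open>U\<close> matter); its inverse is \<^term>\<open>inv_into U \<phi>\<close>.  The atlas need not be
  maximal.\<close>

type_synonym ('a, 'e) chart = "'a set \<times> ('a \<Rightarrow> 'e)"

definition topological_chart :: "'a topology \<Rightarrow> ('a, 'e::euclidean_space) chart \<Rightarrow> bool" where
  "topological_chart M \<kappa> \<longleftrightarrow> (case \<kappa> of (U, \<phi>) \<Rightarrow>
     openin M U \<and> open (\<phi> ` U) \<and>
     homeomorphic_map (subtopology M U) (top_of_set (\<phi> ` U)) \<phi>)"

definition smooth_manifold :: "'a topology \<Rightarrow> ('a, 'e::euclidean_space) chart set \<Rightarrow> bool" where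
  "smooth_manifold M A \<longleftrightarrow>
     Hausdorff_space M \<and> second_countable M \<and>
     (\<forall>\<kappa>\<in>A. topological_chart M \<kappa>) \<and>
     (\<Union>\<kappa>\<in>A. fst \<kappa>) = topspace M \<and>
     (\<forall>(U, \<phi>)\<in>A. \<forall>(V, \<psi>)\<in>A. smooth_on (\<phi> ` (U \<inter> V)) (\<psi> \<circ> inv_into U \<phi>))"


section \<open>Tangent vectors, local vector fields and tensor fields\<close>

text \<open>A tangent vector at \<^term>\<open>p\<close> acts as a derivation on the functions that are smooth near
  \<^term>\<open>p\<close>; by convention it sends every other function to 0.  A vector field assigns a tangent
  vector to every point of its open domain; its values outside of the domain are junk, so that a
  field on \<^term>\<open>U\<close> is also a field on every smaller open set, and fields on \<^term>\<open>U\<close> are compared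
  with \<open>eq_on\<close>.\<close>

type_synonym 'a tvec = "('a \<Rightarrow> real) \<Rightarrow> real"
type_synonym 'a vfield = "'a \<Rightarrow> 'a tvec"

definition tadd :: "'a tvec \<Rightarrow> 'a tvec \<Rightarrow> 'a tvec" where
  "tadd u v = (\<lambda>f. u f + v f)"

definition tscale :: "real \<Rightarrow> 'a tvec \<Rightarrow> 'a tvec" where
  "tscale r u = (\<lambda>f. r * u f)"

abbreviation tzero :: "'a tvec" where
  "tzero \<equiv> (\<lambda>f. 0)"

definition vadd :: "'a vfield \<Rightarrow> 'a vfield \<Rightarrow> 'a vfield" where
  "vadd X Y = (\<lambda>p. tadd (X p) (Y p))"

definition vscale :: "('a \<Rightarrow> real) \<Rightarrow> 'a vfield \<Rightarrow> 'a vfield" where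
  "vscale h X = (\<lambda>p. tscale (h p) (X p))"

abbreviation vminus :: "'a vfield \<Rightarrow> 'a vfield \<Rightarrow> 'a vfield" where
  "vminus X Y \<equiv> vadd X (vscale (\<lambda>p. - 1) Y)"

definition apply_field :: "'a vfield \<Rightarrow> ('a \<Rightarrow> real) \<Rightarrow> 'a \<Rightarrow> real" where
  "apply_field X f = (\<lambda>p. X p f)"

definition eq_on :: "'a set \<Rightarrow> 'a vfield \<Rightarrow> 'a vfield \<Rightarrow> bool" where
  "eq_on U X Y \<longleftrightarrow> (\<forall>p\<in>U. X p = Y p)"

text \<open>The product of an F-manifold and the metric are given as fields of bilinear maps on the
  tangent spaces; \<open>tens t X Y\<close> is the resulting \<open>C\<^sup>\<infinity>\<close>-bilinear operation on vector fields, e.g.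
  the product of \<open>X\<close> and \<open>Y\<close>, or the function \<open>g(X,Y)\<close>.\<close>

definition tens :: "('a \<Rightarrow> 'a tvec \<Rightarrow> 'a tvec \<Rightarrow> 'b) \<Rightarrow> 'a vfield \<Rightarrow> 'a vfield \<Rightarrow> 'a \<Rightarrow> 'b" where
  "tens t X Y = (\<lambda>p. t p (X p) (Y p))"

type_synonym 'a prod_field = "'a \<Rightarrow> 'a tvec \<Rightarrow> 'a tvec \<Rightarrow> 'a tvec"
type_synonym 'a metric_field = "'a \<Rightarrow> 'a tvec \<Rightarrow> 'a tvec \<Rightarrow> real"
type_synonym 'a conn = "'a vfield \<Rightarrow> 'a vfield \<Rightarrow> 'a vfield"

context
  fixes M :: "'a topology" and A :: "('a, 'e::euclidean_space) chart set"
begin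

definition smooth_fun :: "'a set \<Rightarrow> ('a \<Rightarrow> real) \<Rightarrow> bool" where
  "smooth_fun U f \<longleftrightarrow> openin M U \<and>
     (\<forall>(V, \<phi>)\<in>A. smooth_on (\<phi> ` (U \<inter> V)) (f \<circ> inv_into V \<phi>))"

definition smooth_near :: "'a \<Rightarrow> ('a \<Rightarrow> real) \<Rightarrow> bool" where
  "smooth_near p f \<longleftrightarrow> (\<exists>U. p \<in> U \<and> smooth_fun U f)"

text \<open>The tangent vector at \<^term>\<open>p\<close> with components \<^term>\<open>a\<close> in the chart \<^term>\<open>(V, \<phi>)\<close>,
  that is, the sum of the \<open>a\<^sup>i \<partial>/\<partial>x\<^sup>i\<close> at \<^term>\<open>p\<close>.\<close>

definition coord_tvec :: "('a, 'e) chart \<Rightarrow> 'a \<Rightarrow> 'e \<Rightarrow> 'a tvec" where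
  "coord_tvec \<kappa> p a = (case \<kappa> of (V, \<phi>) \<Rightarrow>
     (\<lambda>f. if smooth_near p f then frechet_derivative (f \<circ> inv_into V \<phi>) (at (\<phi> p)) a else 0))"

definition tangent_space :: "'a \<Rightarrow> 'a tvec set" where
  "tangent_space p = {coord_tvec \<kappa> p a | \<kappa> a. \<kappa> \<in> A \<and> p \<in> fst \<kappa>}"

definition vector_field :: "'a set \<Rightarrow> 'a vfield \<Rightarrow> bool" where
  "vector_field U X \<longleftrightarrow> openin M U \<and> (\<forall>p\<in>U. X p \<in> tangent_space p) \<and>
     (\<forall>V f. V \<subseteq> U \<and> smooth_fun V f \<longrightarrow> smooth_fun V (apply_field X f))"

definition lie_bracket :: "'a vfield \<Rightarrow> 'a vfield \<Rightarrow> 'a vfield" where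
  "lie_bracket X Y = (\<lambda>p f. if smooth_near p f
     then X p (apply_field Y f) - Y p (apply_field X f) else 0)"


section \<open>F-manifolds\<close>

definition product_tensor :: "'a prod_field \<Rightarrow> bool" where
  "product_tensor c \<longleftrightarrow>
     (\<forall>p\<in>topspace M. \<forall>u\<in>tangent_space p. \<forall>v\<in>tangent_space p. \<forall>w\<in>tangent_space p. \<forall>r.
        c p u v \<in> tangent_space p \<and>
        c p (tadd u v) w = tadd (c p u w) (c p v w) \<and>
        c p u (tadd v w) = tadd (c p u v) (c p u w) \<and>
        c p (tscale r u) v = tscale r (c p u v) \<and>
        c p u (tscale r v) = tscale r (c p u v)) \<and>
     (\<forall>U X Y. vector_field U X \<and> vector_field U Y \<longrightarrow> vector_field U (tens c X Y))"

text \<open>The value on \<^term>\<open>(Y, Z)\<close> of the Lie derivative of the (1,2)-tensor \<^term>\<open>c\<close> along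
  \<^term>\<open>X\<close>.\<close>

definition lie_deriv_prod :: "'a prod_field \<Rightarrow> 'a vfield \<Rightarrow> 'a vfield \<Rightarrow> 'a vfield \<Rightarrow> 'a vfield" where
  "lie_deriv_prod c X Y Z =
     vminus (vminus (lie_bracket X (tens c Y Z)) (tens c (lie_bracket X Y) Z))
            (tens c Y (lie_bracket X Z))"

definition F_manifold :: "'a prod_field \<Rightarrow> 'a vfield \<Rightarrow> bool" where
  "F_manifold c e \<longleftrightarrow>
     product_tensor c \<and>
     (\<forall>U X Y. vector_field U X \<and> vector_field U Y \<longrightarrow> eq_on U (tens c X Y) (tens c Y X)) \<and>
     (\<forall>U X Y Z. vector_field U X \<and> vector_field U Y \<and> vector_field U Z \<longrightarrow>
        eq_on U (tens c (tens c X Y) Z) (tens c X (tens c Y Z))) \<and>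
     (\<forall>U X Y Z W. vector_field U X \<and> vector_field U Y \<and> vector_field U Z \<and> vector_field U W \<longrightarrow>
        eq_on U (lie_deriv_prod c (tens c X Y) Z W)
          (vadd (tens c X (lie_deriv_prod c Y Z W)) (tens c Y (lie_deriv_prod c X Z W)))) \<and>
     vector_field (topspace M) e \<and>
     (\<forall>U X. vector_field U X \<longrightarrow> eq_on U (tens c e X) X)"


section \<open>Metrics and connections\<close>

definition pseudo_riemannian_metric :: "'a metric_field \<Rightarrow> bool" where
  "pseudo_riemannian_metric g \<longleftrightarrow>
     (\<forall>p\<in>topspace M. \<forall>u\<in>tangent_space p. \<forall>v\<in>tangent_space p. \<forall>w\<in>tangent_space p. \<forall>r.
        g p u v = g p v u \<and>
        g p (tadd u v) w = g p u w + g p v w \<and>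
        g p (tscale r u) v = r * g p u v) \<and>
     (\<forall>p\<in>topspace M. \<forall>u\<in>tangent_space p. (\<forall>v\<in>tangent_space p. g p u v = 0) \<longrightarrow> u = tzero) \<and>
     (\<forall>U X Y. vector_field U X \<and> vector_field U Y \<longrightarrow> smooth_fun U (tens g X Y))"

text \<open>A connection acts on pairs of local vector fields with a common domain.  The second
  condition says that the result does not depend on the junk values outside of the domain;
  together with the first one it makes the connection compatible with restriction to smaller
  open sets.\<close>

definition connection :: "'a conn \<Rightarrow> bool" where
  "connection nabla \<longleftrightarrow>
     (\<forall>U X Y. vector_field U X \<and> vector_field U Y \<longrightarrow> vector_field U (nabla X Y)) \<and>
     (\<forall>U X X' Y Y'. vector_field U X \<and> vector_field U X' \<and> vector_field U Y \<and> vector_field U Y' \<and>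
        eq_on U X X' \<and> eq_on U Y Y' \<longrightarrow> eq_on U (nabla X Y) (nabla X' Y')) \<and>
     (\<forall>U X Y Z. vector_field U X \<and> vector_field U Y \<and> vector_field U Z \<longrightarrow>
        eq_on U (nabla (vadd X Y) Z) (vadd (nabla X Z) (nabla Y Z)) \<and>
        eq_on U (nabla X (vadd Y Z)) (vadd (nabla X Y) (nabla X Z))) \<and>
     (\<forall>U X Y h. vector_field U X \<and> vector_field U Y \<and> smooth_fun U h \<longrightarrow>
        eq_on U (nabla (vscale h X) Y) (vscale h (nabla X Y)) \<and>
        eq_on U (nabla X (vscale h Y)) (vadd (vscale (apply_field X h) Y) (vscale h (nabla X Y))))"

definition torsionless :: "'a conn \<Rightarrow> bool" where
  "torsionless nabla \<longleftrightarrow> (\<forall>U X Y. vector_field U X \<and> vector_field U Y \<longrightarrow>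
     eq_on U (vminus (nabla X Y) (nabla Y X)) (lie_bracket X Y))"

definition riemann_tensor :: "'a conn \<Rightarrow> 'a vfield \<Rightarrow> 'a vfield \<Rightarrow> 'a vfield \<Rightarrow> 'a vfield" where
  "riemann_tensor nabla X Y Z =
     vminus (vminus (nabla X (nabla Y Z)) (nabla Y (nabla X Z))) (nabla (lie_bracket X Y) Z)"

text \<open>\<open>cov_deriv_metric nabla g X Y Z\<close> is the function \<open>(\<nabla>\<^sub>X g)(Y,Z)\<close>.\<close>

definition cov_deriv_metric ::
  "'a conn \<Rightarrow> 'a metric_field \<Rightarrow> 'a vfield \<Rightarrow> 'a vfield \<Rightarrow> 'a vfield \<Rightarrow> 'a \<Rightarrow> real" where
  "cov_deriv_metric nabla g X Y Z = (\<lambda>p.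
     apply_field X (tens g Y Z) p - tens g (nabla X Y) Z p - tens g Y (nabla X Z) p)"

definition levi_civita :: "'a metric_field \<Rightarrow> 'a conn \<Rightarrow> bool" where
  "levi_civita g D \<longleftrightarrow> connection D \<and> torsionless D \<and>
     (\<forall>U X Y Z. vector_field U X \<and> vector_field U Y \<and> vector_field U Z \<longrightarrow>
        (\<forall>p\<in>U. cov_deriv_metric D g X Y Z p = 0))"

definition killing :: "'a metric_field \<Rightarrow> 'a vfield \<Rightarrow> bool" where
  "killing g e \<longleftrightarrow> (\<forall>U Y Z. vector_field U Y \<and> vector_field U Z \<longrightarrow>
     (\<forall>p\<in>U. apply_field e (tens g Y Z) p - tens g (lie_bracket e Y) Z p
            - tens g Y (lie_bracket e Z) p = 0))"

text \<open>The Levi-Civita connection \<^term>\<open>D\<close> is unique up to junk values (on arguments that are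
  not vector fields, and at points outside of the domain); hence the quantifier instead of a
  choice.\<close>

definition riemannian_F_manifold_killing ::
  "'a prod_field \<Rightarrow> 'a metric_field \<Rightarrow> 'a vfield \<Rightarrow> bool" where
  "riemannian_F_manifold_killing c g e \<longleftrightarrow>
     F_manifold c e \<and>
     pseudo_riemannian_metric g \<and>
     (\<forall>U X Y Z. vector_field U X \<and> vector_field U Y \<and> vector_field U Z \<longrightarrow>
        (\<forall>p\<in>U. tens g (tens c X Y) Z p = tens g X (tens c Y Z) p)) \<and>
     (\<exists>D. levi_civita g D \<and>
        (\<forall>U X Y Z W. vector_field U X \<and> vector_field U Y \<and> vector_field U Z \<and> vector_field U W \<longrightarrow>
           eq_on U
             (vadd (vadd (riemann_tensor D Y Z (tens c X W)) (riemann_tensor D X Y (tens c Z W)))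
                   (riemann_tensor D Z X (tens c Y W)))
             (\<lambda>p. tzero))) \<and>
     killing g e"


section \<open>The associated flat connection and Legendre fields\<close>

text \<open>The value on \<^term>\<open>(X, Y)\<close> of the exterior derivative of the one-form \<open>\<theta>(X) = g(e,X)\<close>.\<close>

definition d_theta :: "'a metric_field \<Rightarrow> 'a vfield \<Rightarrow> 'a vfield \<Rightarrow> 'a vfield \<Rightarrow> 'a \<Rightarrow> real" where
  "d_theta g e X Y = (\<lambda>p. apply_field X (tens g e Y) p - apply_field Y (tens g e X) p
     - tens g e (lie_bracket X Y) p)"

text \<open>These conditions determine \<^term>\<open>nabla\<close> (up to junk values); that \<^term>\<open>nabla\<close> is flat is a theorem
  and not part of the definition.\<close>

definition associated_flat_connection ::
  "'a prod_field \<Rightarrow> 'a metric_field \<Rightarrow> 'a vfield \<Rightarrow> 'a conn \<Rightarrow> bool" where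
  "associated_flat_connection c g e nabla \<longleftrightarrow>
     connection nabla \<and> torsionless nabla \<and>
     (\<forall>U X Y Z. vector_field U X \<and> vector_field U Y \<and> vector_field U Z \<longrightarrow>
        (\<forall>p\<in>U. cov_deriv_metric nabla g X Y Z p =
           1/2 * d_theta g e (tens c X Y) Z p + 1/2 * d_theta g e (tens c X Z) Y p))"

definition inverse_field :: "'a prod_field \<Rightarrow> 'a vfield \<Rightarrow> 'a vfield \<Rightarrow> 'a vfield \<Rightarrow> bool" where
  "inverse_field c e X Y \<longleftrightarrow> vector_field (topspace M) Y \<and> eq_on (topspace M) (tens c X Y) e"

definition legendre_field :: "'a prod_field \<Rightarrow> 'a vfield \<Rightarrow> 'a conn \<Rightarrow> 'a vfield \<Rightarrow> bool" where
  "legendre_field c e nabla X \<longleftrightarrow>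
     vector_field (topspace M) X \<and> (\<exists>Y. inverse_field c e X Y) \<and>
     (\<forall>U Y Z. vector_field U Y \<and> vector_field U Z \<longrightarrow>
        eq_on U (tens c Y (nabla Z X)) (tens c Z (nabla Y X)))"

definition flat_field :: "'a conn \<Rightarrow> 'a vfield \<Rightarrow> bool" where
  "flat_field nabla X \<longleftrightarrow> (\<forall>U Y. vector_field U Y \<longrightarrow> eq_on U (nabla Y X) (\<lambda>p. tzero))"

end

end

theory Submission
  imports Defs
begin

text \<open>Let \<open>D\<close> be the Levi-Civita connection of \<open>g\<close> and \<open>\<omega>(X,Y) = g(D\<^sub>X e, Y)\<close>.  That \<open>e\<close> is a Killing
  field means that \<open>\<omega>\<close> is skew, and then \<open>d\<theta> = 2\<omega>\<close>.  Hence the associated flat connection is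
  \<open>\<nabla>\<^sub>X Y = D\<^sub>X Y - D\<^bsub>X \<circ> Y\<^esub> e\<close> (\<open>associated_flat_connection_iff\<close>), and a field \<open>L\<close> is flat if and only if
  \<open>D\<^sub>Y L = D\<^bsub>L \<circ> Y\<^esub> e\<close>.

  Everything new is obtained from the old by conjugation with the invertible flat field \<open>L\<close>.  The
  Levi-Civita connection of \<open>g(L \<circ> Y, L \<circ> Z)\<close> is \<open>L\<^sup>-\<^sup>1 \<circ> D\<^sub>Y(L \<circ> Z)\<close>: compatibility with the metric is
  obvious, and torsion-freeness amounts to
  \<open>D\<^sub>Y(L \<circ> Z) - D\<^sub>Z(L \<circ> Y) = L \<circ> [Y,Z]\<close> (\<open>D_mult_torsion\<close>).  Given this, the curvature tensor is
  conjugated, so it satisfies the same cyclic identity; the form \<open>\<omega>\<close> of the new metric is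
  \<open>\<omega>(L \<circ> X, L \<circ> Y)\<close>, so it is skew and \<open>e\<close> is a Killing field again; and conjugating the formula for \<open>\<nabla>\<close>
  gives the formula for the new associated flat connection, by the same characterization.

  The torsion identity is where the F-manifold enters.  Let \<open>a\<^sub>W(X,Y,Z) = g((D\<^sub>W c)(X,Y), Z)\<close>, which is
  totally symmetric in \<open>X\<close>, \<open>Y\<close>, \<open>Z\<close> by invariance of \<open>g\<close>.  Pairing the F-manifold identity with \<open>e\<close> gives
  \<open>a\<^sub>Z + a\<^sub>W - a\<^sub>X - a\<^sub>Y = 2 \<omega>(X \<circ> Y, Z \<circ> W)\<close>, each \<open>a\<close> evaluated on the remaining three fields, and a
  permutation of the fields yields
  \<open>a\<^sub>Z - a\<^sub>Y = \<omega>(X \<circ> Y, Z \<circ> W) + \<omega>(W \<circ> Y, Z \<circ> X)\<close> (\<open>Dc_exchange\<close>).  For a flat \<open>L\<close> these terms cancel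
  against the derivatives of \<open>L\<close>.

  The algebra is done after pairing with test fields.  This requires that tangent vectors extend to
  local vector fields and that local fields form a module over the smooth functions, which
  rests on closure of smoothness under products and composition.\<close>

section \<open>Calculus of continuously differentiable functions\<close>

lemma frechet_derivative_cong_open:
  assumes "open S" "x \<in> S" "\<And>y. y \<in> S \<Longrightarrow> f y = f' y"
  shows "f differentiable at x \<longleftrightarrow> f' differentiable at x"
    and "frechet_derivative f (at x) = frechet_derivative f' (at x)"
proof -
  have iff: "(f has_derivative d) (at x) \<longleftrightarrow> (f' has_derivative d) (at x)" for d
    using has_derivative_transform_within_open[OF _ assms(1,2), of f d UNIV f']
      has_derivative_transform_within_open[OF _ assms(1,2), of f' d UNIV f] assms(3) by auto
  then show "f differentiable at x \<longleftrightarrow> f' differentiable at x"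
    by (simp add: differentiable_def)
  show "frechet_derivative f (at x) = frechet_derivative f' (at x)"
    unfolding frechet_derivative_def iff ..
qed

lemma Ck_on_cong:
  assumes "open S" "\<And>x. x \<in> S \<Longrightarrow> f x = f' x" "Ck_on k S f"
  shows "Ck_on k S f'"
  using assms(2,3)
proof (induction k arbitrary: f f')
  case 0
  then show ?case using continuous_on_cong[of S S f f'] by auto
next
  case (Suc k)
  note D = frechet_derivative_cong_open[OF assms(1) _ Suc.prems(1)]
  have "Ck_on k S (\<lambda>x. frechet_derivative f' (at x) v)" for v
    using Suc.IH[of "\<lambda>x. frechet_derivative f (at x) v" "\<lambda>x. frechet_derivative f' (at x) v"]
      Suc.prems D(2) by auto
  then show ?case using Suc.prems D(1) by auto
qed

lemma Ck_on_subset: "Ck_on k S f \<Longrightarrow> T \<subseteq> S \<Longrightarrow> Ck_on k T f"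
  by (induction k arbitrary: f) (auto intro: continuous_on_subset)

lemma Ck_on_SucD: "Ck_on (Suc k) S f \<Longrightarrow> Ck_on k S f"
  by (induction k arbitrary: f)
    (auto intro!: continuous_at_imp_continuous_on differentiable_imp_continuous_within)

text \<open>Induction on the order of differentiability needs the derivative in closed form; this rule allows
  any formula for it in place of the derivative chosen by \<^const>\<open>frechet_derivative\<close>.\<close>

lemma Ck_on_SucI:
  assumes "open S" "\<And>x. x \<in> S \<Longrightarrow> (f has_derivative f' x) (at x)"
    "\<And>v. Ck_on k S (\<lambda>x. f' x v)"
  shows "Ck_on (Suc k) S f"
proof -
  have "frechet_derivative f (at x) = f' x" if "x \<in> S" for x
    using assms(2)[OF that] frechet_derivative_at by metis
  then show ?thesis
    using assms by (auto simp: differentiable_def intro: Ck_on_cong[OF assms(1) _ assms(3)])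
qed

lemma Ck_on_SucE:
  assumes "Ck_on (Suc k) S f" "x \<in> S"
  shows "(f has_derivative frechet_derivative f (at x)) (at x)"
  using assms by (auto simp: frechet_derivative_works)

lemma Ck_on_const: "open S \<Longrightarrow> Ck_on k S (\<lambda>x. a)"
proof (induction k arbitrary: a)
  case (Suc k)
  then show ?case by (intro Ck_on_SucI[where f' = "\<lambda>_ _. 0"]) auto
qed auto

lemma Ck_on_add:
  "open S \<Longrightarrow> Ck_on k S f \<Longrightarrow> Ck_on k S h \<Longrightarrow> Ck_on k S (\<lambda>x. f x + h x)"
proof (induction k arbitrary: f h)
  case (Suc k)
  show ?case
    by (rule Ck_on_SucI[OF Suc.prems(1) has_derivative_add[OF Ck_on_SucE[OF Suc.prems(2)]
          Ck_on_SucE[OF Suc.prems(3)]]]) (use Suc in auto)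
qed (auto intro: continuous_on_add)

lemma Ck_on_sum:
  "open S \<Longrightarrow> (\<And>i. i \<in> I \<Longrightarrow> Ck_on k S (f i)) \<Longrightarrow> Ck_on k S (\<lambda>x. \<Sum>i\<in>I. f i x)"
  by (induction I rule: infinite_finite_induct) (auto intro: Ck_on_add Ck_on_const)

lemma Ck_on_bounded_linear:
  assumes "open S" "bounded_linear h"
  shows "Ck_on k S f \<Longrightarrow> Ck_on k S (\<lambda>x. h (f x))"
proof (induction k arbitrary: f)
  case 0
  then show ?case using bounded_linear.continuous_on[OF assms(2)] by auto
next
  case (Suc k)
  show ?case
    by (rule Ck_on_SucI[OF assms(1) bounded_linear.has_derivative[OF assms(2)
          Ck_on_SucE[OF Suc.prems]]]) (use Suc in auto)
qed

lemma Ck_on_scaleR: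
  fixes f :: "'e::euclidean_space \<Rightarrow> real"
  shows "open S \<Longrightarrow> Ck_on k S f \<Longrightarrow> Ck_on k S h \<Longrightarrow> Ck_on k S (\<lambda>x. f x *\<^sub>R h x)"
proof (induction k arbitrary: f h)
  case (Suc k)
  show ?case
  proof (rule Ck_on_SucI[OF Suc.prems(1) has_derivative_scaleR[OF Ck_on_SucE[OF Suc.prems(2)]
          Ck_on_SucE[OF Suc.prems(3)]]])
    fix v
    show "Ck_on k S (\<lambda>x. f x *\<^sub>R frechet_derivative h (at x) v + frechet_derivative f (at x) v *\<^sub>R h x)"
      using Suc.prems Ck_on_SucD[OF Suc.prems(2)] Ck_on_SucD[OF Suc.prems(3)]
      by (intro Ck_on_add Suc.IH) auto
  qed
qed (auto intro: continuous_on_scaleR)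

text \<open>The chain rule expresses the derivative of a composition by the value of the outer derivative on a
  vector that varies with the point, a form to which the induction hypothesis does not apply.
  Expanding this vector in the standard basis yields a sum of products of functions, each of them
  covered by the rules above or by the induction hypothesis.\<close>

lemma Ck_on_compose:
  fixes f :: "'e::euclidean_space \<Rightarrow> 'd::euclidean_space"
  assumes "open S" "open T" "f ` S \<subseteq> T"
  shows "Ck_on k S f \<Longrightarrow> Ck_on k T h \<Longrightarrow> Ck_on k S (\<lambda>x. h (f x))"
proof (induction k arbitrary: h)
  case 0
  then show ?case using continuous_on_compose2[of T h S f] assms by auto
next
  case (Suc k)
  have in_T: "f x \<in> T" if "x \<in> S" for x using assms that by auto
  note df = Ck_on_SucE[OF Suc.prems(1)] and dh = Ck_on_SucE[OF Suc.prems(2) in_T]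
  show ?case
  proof (rule Ck_on_SucI[OF assms(1)])
    fix x assume x: "x \<in> S"
    show "((\<lambda>x. h (f x)) has_derivative
        (\<lambda>v. \<Sum>b\<in>Basis. (frechet_derivative f (at x) v \<bullet> b) *\<^sub>R frechet_derivative h (at (f x)) b)) (at x)"
    proof -
      interpret dh: linear "frechet_derivative h (at (f x))"
        using dh[OF x] has_derivative_linear by blast
      have *: "frechet_derivative h (at (f x)) w = (\<Sum>b\<in>Basis. (w \<bullet> b) *\<^sub>R frechet_derivative h (at (f x)) b)" for w
        by (subst euclidean_representation[of w, symmetric]) (simp add: dh.sum dh.scale)
      show ?thesis
        using has_derivative_compose[OF df[OF x] dh[OF x]] *[symmetric] by simp
    qed
  next
    fix v
    show "Ck_on k S (\<lambda>x. \<Sum>b\<in>Basis. (frechet_derivative f (at x) v \<bullet> b) *\<^sub>R frechet_derivative h (at (f x)) b)"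
      using Suc.prems Ck_on_SucD[OF Suc.prems(1)]
      by (intro Ck_on_sum Ck_on_scaleR Ck_on_bounded_linear[OF _ bounded_linear_inner_left]
          Suc.IH assms(1)) auto
  qed
qed

section \<open>Tangent spaces and local vector fields\<close>

locale atlas =
  fixes M :: "'a topology" and A :: "('a, 'e::euclidean_space) chart set"
  assumes manifold: "smooth_manifold M A"
begin

abbreviation "T \<equiv> tangent_space M A"
abbreviation "VF \<equiv> vector_field M A"
abbreviation "smooth \<equiv> smooth_fun M A"
abbreviation "bracket \<equiv> lie_bracket M A"

lemma chart:
  assumes "(V, \<phi>) \<in> A"
  shows chart_openin: "openin M V" and chart_inj: "inj_on \<phi> V"
    and chart_open: "openin M U \<Longrightarrow> open (\<phi> ` (U \<inter> V))"
proof -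
  have V: "openin M V" "open (\<phi> ` V)"
    and hom: "homeomorphic_map (subtopology M V) (top_of_set (\<phi> ` V)) \<phi>"
    using manifold assms by (auto simp: smooth_manifold_def topological_chart_def)
  show "openin M V" by fact
  have "topspace (subtopology M V) = V"
    using openin_subset[OF V(1)] by auto
  then show "inj_on \<phi> V" using homeomorphic_imp_injective_map[OF hom] by simp
  assume "openin M U"
  then have "openin (subtopology M V) (U \<inter> V)" by (rule openin_subtopology_Int)
  then have "openin (top_of_set (\<phi> ` V)) (\<phi> ` (U \<inter> V))"
    using homeomorphic_imp_open_map[OF hom] by (simp add: open_map_def)
  then show "open (\<phi> ` (U \<inter> V))" using V(2) openin_open_eq by blast
qed

lemma chart_cover:
  assumes "p \<in> topspace M" shows "\<exists>V \<phi>. (V, \<phi>) \<in> A \<and> p \<in> V"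
proof -
  have "topspace M = (\<Union>\<kappa>\<in>A. fst \<kappa>)"
    using manifold unfolding smooth_manifold_def by simp
  then show ?thesis using assms by auto
qed

lemma chart_inv: "(V, \<phi>) \<in> A \<Longrightarrow> q \<in> V \<Longrightarrow> inv_into V \<phi> (\<phi> q) = q"
  using chart_inj by simp

lemma transition_smooth:
  assumes "(U, \<phi>) \<in> A" "(V, \<psi>) \<in> A"
  shows "smooth_on (\<phi> ` (U \<inter> V)) (\<psi> \<circ> inv_into U \<phi>)"
proof -
  have "\<forall>(U, \<phi>)\<in>A. \<forall>(V, \<psi>)\<in>A. smooth_on (\<phi> ` (U \<inter> V)) (\<psi> \<circ> inv_into U \<phi>)"
    using manifold unfolding smooth_manifold_def by simp
  with assms show ?thesis by fast
qed

lemma smooth_openin: "smooth U f \<Longrightarrow> openin M U"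
  by (simp add: smooth_fun_def)

lemma smoothI:
  "openin M U \<Longrightarrow> (\<And>V \<phi> k. (V, \<phi>) \<in> A \<Longrightarrow> Ck_on k (\<phi> ` (U \<inter> V)) (\<lambda>x. f (inv_into V \<phi> x)))
    \<Longrightarrow> smooth U f"
  by (auto simp: smooth_fun_def smooth_on_def comp_def)

lemma smoothD: "smooth U f \<Longrightarrow> (V, \<phi>) \<in> A \<Longrightarrow> Ck_on k (\<phi> ` (U \<inter> V)) (\<lambda>x. f (inv_into V \<phi> x))"
  by (auto simp: smooth_fun_def smooth_on_def comp_def)

lemma smooth_cong:
  assumes "smooth U f" "\<And>q. q \<in> U \<Longrightarrow> f q = f' q"
  shows "smooth U f'"
proof (rule smoothI)
  show U: "openin M U" using assms smooth_openin by blast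
  fix V \<phi> k assume "(V, \<phi>) \<in> A"
  then show "Ck_on k (\<phi> ` (U \<inter> V)) (\<lambda>x. f' (inv_into V \<phi> x))"
    using assms(2)
    by (intro Ck_on_cong[OF chart_open[OF _ U] _ smoothD[OF assms(1)]]) (auto simp: chart_inv)
qed

lemma smooth_subset:
  assumes "smooth U f" "openin M V" "V \<subseteq> U" shows "smooth V f"
proof (rule smoothI[OF assms(2)])
  show "Ck_on k (\<phi> ` (V \<inter> W)) (\<lambda>x. f (inv_into W \<phi> x))" if "(W, \<phi>) \<in> A" for W \<phi> k
    using assms(3) by (intro Ck_on_subset[OF smoothD[OF assms(1) that]]) auto
qed

lemma smooth_const: "openin M U \<Longrightarrow> smooth U (\<lambda>q. r)"
  by (rule smoothI[OF _ Ck_on_const[OF chart_open]])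

lemma smooth_add:
  assumes "smooth U f" "smooth U h" shows "smooth U (\<lambda>q. f q + h q)"
proof (rule smoothI)
  show "openin M U" using assms smooth_openin by blast
  then show "Ck_on k (\<phi> ` (U \<inter> V)) (\<lambda>x. f (inv_into V \<phi> x) + h (inv_into V \<phi> x))"
    if "(V, \<phi>) \<in> A" for V \<phi> k
    using that by (intro Ck_on_add chart_open smoothD[OF assms(1)] smoothD[OF assms(2)])
qed

lemma smooth_mult:
  assumes "smooth U f" "smooth U h" shows "smooth U (\<lambda>q. f q * h q)"
proof (rule smoothI)
  show "openin M U" using assms smooth_openin by blast
  then show "Ck_on k (\<phi> ` (U \<inter> V)) (\<lambda>x. f (inv_into V \<phi> x) * h (inv_into V \<phi> x))"
    if "(V, \<phi>) \<in> A" for V \<phi> k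
    using that Ck_on_scaleR[OF chart_open smoothD[OF assms(1)] smoothD[OF assms(2)]] by simp
qed

lemma smooth_near_cong:
  assumes "openin M U" "p \<in> U" "\<And>q. q \<in> U \<Longrightarrow> f q = f' q" "smooth_near M A p f"
  shows "smooth_near M A p f'"
proof -
  obtain V where V: "p \<in> V" "smooth V f" using assms(4) by (auto simp: smooth_near_def)
  then have "smooth (U \<inter> V) f'"
    using assms smooth_openin[OF V(2)]
    by (intro smooth_cong[OF smooth_subset[OF V(2)]]) auto
  then show ?thesis using V assms(2) by (auto simp: smooth_near_def)
qed

lemma coord_tvec_eq:
  "coord_tvec M A (V, \<phi>) p a =
    (\<lambda>f. if smooth_near M A p f then frechet_derivative (\<lambda>x. f (inv_into V \<phi> x)) (at (\<phi> p)) a else 0)"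
  unfolding coord_tvec_def comp_def by simp

lemma smooth_near_has_derivative:
  assumes "smooth_near M A p f" "(V, \<phi>) \<in> A" "p \<in> V"
  shows "((\<lambda>x. f (inv_into V \<phi> x)) has_derivative
    frechet_derivative (\<lambda>x. f (inv_into V \<phi> x)) (at (\<phi> p))) (at (\<phi> p))"
proof -
  obtain U where "p \<in> U" "smooth U f" using assms(1) by (auto simp: smooth_near_def)
  then show ?thesis using assms(2,3) by (intro Ck_on_SucE[OF smoothD[where k = "Suc 0"]]) auto
qed

text \<open>Metrics and products are multiplied out on the domain of the fields only, so two expressions for
  the same function may differ outside of it; a tangent vector does not see the difference.\<close>

lemma tangent_local:
  assumes "u \<in> T p" "openin M U" "p \<in> U" "\<And>q. q \<in> U \<Longrightarrow> f q = f' q"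
  shows "u f = u f'"
proof -
  obtain V \<phi> a where V: "(V, \<phi>) \<in> A" "p \<in> V" and u: "u = coord_tvec M A (V, \<phi>) p a"
    using assms(1) by (auto simp: tangent_space_def)
  have "smooth_near M A p f \<longleftrightarrow> smooth_near M A p f'"
    using smooth_near_cong[OF assms(2,3)] assms(4) by metis
  moreover have "frechet_derivative (\<lambda>x. f (inv_into V \<phi> x)) (at (\<phi> p)) =
      frechet_derivative (\<lambda>x. f' (inv_into V \<phi> x)) (at (\<phi> p))"
    using V assms
    by (intro frechet_derivative_cong_open[OF chart_open[OF V(1) assms(2)]]) (auto simp: chart_inv)
  ultimately show ?thesis by (simp add: u coord_tvec_eq)
qed

text \<open>The chain rule for the transition map.  Every tangent vector can thus be written in a single chart,
  which turns the tangent space, a union over all charts, into a vector space.\<close>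

lemma coord_change:
  assumes V: "(V, \<phi>) \<in> A" "p \<in> V" and W: "(W, \<psi>) \<in> A" "p \<in> W"
  shows "coord_tvec M A (W, \<psi>) p a =
    coord_tvec M A (V, \<phi>) p (frechet_derivative (\<phi> \<circ> inv_into W \<psi>) (at (\<psi> p)) a)"
proof
  fix f
  let ?t = "\<phi> \<circ> inv_into W \<psi>"
  show "coord_tvec M A (W, \<psi>) p a f = coord_tvec M A (V, \<phi>) p (frechet_derivative ?t (at (\<psi> p)) a) f"
  proof (cases "smooth_near M A p f")
    case True
    have t: "(?t has_derivative frechet_derivative ?t (at (\<psi> p))) (at (\<psi> p))"
      using transition_smooth[OF W(1) V(1)] V W
      by (intro Ck_on_SucE[where k = 0 and S = "\<psi> ` (W \<inter> V)"]) (auto simp: smooth_on_def simp del: Ck_on.simps)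
    have tp: "?t (\<psi> p) = \<phi> p" using W by (simp add: chart_inv)
    have "((\<lambda>x. f (inv_into V \<phi> (?t x))) has_derivative
        (\<lambda>b. frechet_derivative (\<lambda>x. f (inv_into V \<phi> x)) (at (\<phi> p)) (frechet_derivative ?t (at (\<psi> p)) b))) (at (\<psi> p))"
      using has_derivative_compose[OF t, unfolded tp, OF smooth_near_has_derivative[OF True V]] .
    then have "frechet_derivative (\<lambda>x. f (inv_into V \<phi> (?t x))) (at (\<psi> p)) =
        (\<lambda>b. frechet_derivative (\<lambda>x. f (inv_into V \<phi> x)) (at (\<phi> p)) (frechet_derivative ?t (at (\<psi> p)) b))"
      using frechet_derivative_at by metis
    moreover have "frechet_derivative (\<lambda>x. f (inv_into V \<phi> (?t x))) (at (\<psi> p)) =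
        frechet_derivative (\<lambda>x. f (inv_into W \<psi> x)) (at (\<psi> p))"
      using V W chart_openin
      by (intro frechet_derivative_cong_open[OF chart_open[OF W(1) chart_openin[OF V(1)]]])
        (auto simp: chart_inv)
    ultimately have eq: "frechet_derivative (\<lambda>x. f (inv_into W \<psi> x)) (at (\<psi> p)) =
        (\<lambda>b. frechet_derivative (\<lambda>x. f (inv_into V \<phi> x)) (at (\<phi> p)) (frechet_derivative ?t (at (\<psi> p)) b))"
      by (simp only:)
    show ?thesis unfolding coord_tvec_eq if_P[OF True] eq ..
  qed (simp add: coord_tvec_eq)
qed

lemma tangent_space_chart:
  assumes "(V, \<phi>) \<in> A" "p \<in> V"
  shows "T p = range (coord_tvec M A (V, \<phi>) p)"
proof
  show "T p \<subseteq> range (coord_tvec M A (V, \<phi>) p)"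
    using coord_change[OF assms] by (auto simp: tangent_space_def)
  show "range (coord_tvec M A (V, \<phi>) p) \<subseteq> T p"
    using assms by (force simp: tangent_space_def)
qed

lemma coord_linear:
  assumes "(V, \<phi>) \<in> A" "p \<in> V"
  shows "tadd (coord_tvec M A (V, \<phi>) p a) (coord_tvec M A (V, \<phi>) p b) = coord_tvec M A (V, \<phi>) p (a + b)"
    and "tscale r (coord_tvec M A (V, \<phi>) p a) = coord_tvec M A (V, \<phi>) p (r *\<^sub>R a)"
proof -
  have "linear (frechet_derivative (\<lambda>x. f (inv_into V \<phi> x)) (at (\<phi> p)))" if "smooth_near M A p f" for f
    using has_derivative_linear[OF smooth_near_has_derivative[OF that assms]] .
  then show "tadd (coord_tvec M A (V, \<phi>) p a) (coord_tvec M A (V, \<phi>) p b) = coord_tvec M A (V, \<phi>) p (a + b)"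
    and "tscale r (coord_tvec M A (V, \<phi>) p a) = coord_tvec M A (V, \<phi>) p (r *\<^sub>R a)"
    by (simp_all add: tadd_def tscale_def coord_tvec_eq fun_eq_iff linear_add linear_scale)
qed

lemma tangent_tadd: 
  assumes "p \<in> topspace M" "u \<in> T p" "v \<in> T p" shows "tadd u v \<in> T p"
proof -
  obtain V \<phi> where V: "(V, \<phi>) \<in> A" "p \<in> V" using chart_cover[OF assms(1)] by blast
  then show ?thesis
    using assms(2,3) coord_linear(1)[OF V] by (auto simp: tangent_space_chart[OF V])
qed

lemma tangent_tscale:
  assumes "p \<in> topspace M" "u \<in> T p" shows "tscale r u \<in> T p"
proof -
  obtain V \<phi> where V: "(V, \<phi>) \<in> A" "p \<in> V" using chart_cover[OF assms(1)] by blast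
  then show ?thesis
    using assms(2) coord_linear(2)[OF V] by (auto simp: tangent_space_chart[OF V])
qed

lemma VF_openin: "VF U X \<Longrightarrow> openin M U"
  by (simp add: vector_field_def)

lemma VF_point: "VF U X \<Longrightarrow> p \<in> U \<Longrightarrow> p \<in> topspace M"
  using VF_openin openin_subset by blast

lemma VF_tangent: "VF U X \<Longrightarrow> p \<in> U \<Longrightarrow> X p \<in> T p"
  by (simp add: vector_field_def)

lemma VF_smooth: "VF U X \<Longrightarrow> smooth U f \<Longrightarrow> smooth U (apply_field X f)"
  by (simp add: vector_field_def)

lemma VF_subset: "VF U X \<Longrightarrow> openin M V \<Longrightarrow> V \<subseteq> U \<Longrightarrow> VF V X"
  by (auto simp: vector_field_def)

lemma VF_cong:
  assumes "VF U X" "eq_on U X Y" shows "VF U Y"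
  unfolding vector_field_def
proof (intro conjI ballI allI impI)
  show "openin M U" using assms VF_openin by blast
  show "Y p \<in> T p" if "p \<in> U" for p using assms that VF_tangent by (metis eq_on_def)
  fix V f assume V: "V \<subseteq> U \<and> smooth V f"
  then have "smooth V (apply_field X f)" using assms by (simp add: vector_field_def)
  then show "smooth V (apply_field Y f)"
    by (rule smooth_cong) (use V assms in \<open>auto simp: apply_field_def eq_on_def\<close>)
qed

lemma VF_vadd:
  assumes "VF U X" "VF U Y" shows "VF U (vadd X Y)"
proof -
  have f: "apply_field (vadd X Y) f = (\<lambda>q. apply_field X f q + apply_field Y f q)" for f
    by (simp add: fun_eq_iff apply_field_def vadd_def tadd_def)
  show ?thesis
    unfolding vector_field_def f
  proof (intro conjI ballI allI impI)
    show "openin M U" using assms VF_openin by blast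
    show "vadd X Y p \<in> T p" if "p \<in> U" for p
      unfolding vadd_def by (intro tangent_tadd VF_tangent[OF _ that] assms VF_point[OF assms(1) that])
    show "smooth V (\<lambda>q. apply_field X f q + apply_field Y f q)" if "V \<subseteq> U \<and> smooth V f" for V f
      using assms that by (intro smooth_add) (simp_all add: vector_field_def)
  qed
qed

lemma VF_vscale:
  assumes "VF U X" "smooth U h" shows "VF U (vscale h X)"
proof -
  have f: "apply_field (vscale h X) f = (\<lambda>q. h q * apply_field X f q)" for f
    by (simp add: fun_eq_iff apply_field_def vscale_def tscale_def)
  show ?thesis
    unfolding vector_field_def f
  proof (intro conjI ballI allI impI)
    show "openin M U" using assms VF_openin by blast
    show "vscale h X p \<in> T p" if "p \<in> U" for p
      unfolding vscale_def by (intro tangent_tscale VF_tangent[OF _ that] assms VF_point[OF assms(1) that])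
    show "smooth V (\<lambda>q. h q * apply_field X f q)" if "V \<subseteq> U \<and> smooth V f" for V f
      using assms that smooth_subset[OF assms(2) smooth_openin]
      by (intro smooth_mult) (auto simp add: vector_field_def)
  qed
qed

lemma VF_vminus: "VF U X \<Longrightarrow> VF U Y \<Longrightarrow> VF U (vminus X Y)"
  by (intro VF_vadd VF_vscale smooth_const VF_openin)

text \<open>A coordinate field with constant components.  In another chart it acts by a directional derivative
  composed with the transition map, which is where composition of smooth functions is needed.\<close>

lemma VF_coord:
  assumes V: "(V, \<phi>) \<in> A"
  shows "VF V (\<lambda>q. coord_tvec M A (V, \<phi>) q a)"
  unfolding vector_field_def
proof (intro conjI ballI allI impI)
  show "openin M V" using chart_openin[OF V] .
  show "coord_tvec M A (V, \<phi>) q a \<in> T q" if "q \<in> V" for q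
    using tangent_space_chart[OF V that] by simp
  fix U f assume "U \<subseteq> V \<and> smooth U f"
  then have U: "U \<subseteq> V" "smooth U f" by auto
  let ?F = "\<lambda>y. frechet_derivative (\<lambda>x. f (inv_into V \<phi> x)) (at y) a"
  show "smooth U (apply_field (\<lambda>q. coord_tvec M A (V, \<phi>) q a) f)"
  proof (rule smoothI)
    show oU: "openin M U" using smooth_openin[OF U(2)] .
    fix W \<psi> k assume W: "(W, \<psi>) \<in> A"
    have "Ck_on k (\<psi> ` (U \<inter> W)) (\<lambda>x. ?F ((\<phi> \<circ> inv_into W \<psi>) x))"
    proof (rule Ck_on_compose[OF chart_open[OF W oU] chart_open[OF V oU]])
      show "(\<phi> \<circ> inv_into W \<psi>) ` \<psi> ` (U \<inter> W) \<subseteq> \<phi> ` (U \<inter> V)"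
        using U(1) W by (auto simp: chart_inv)
      show "Ck_on k (\<psi> ` (U \<inter> W)) (\<phi> \<circ> inv_into W \<psi>)"
      proof (rule Ck_on_subset)
        show "Ck_on k (\<psi> ` (W \<inter> V)) (\<phi> \<circ> inv_into W \<psi>)"
          using transition_smooth[OF W V] by (simp add: smooth_on_def)
        show "\<psi> ` (U \<inter> W) \<subseteq> \<psi> ` (W \<inter> V)" using U(1) by auto
      qed
      show "Ck_on k (\<phi> ` (U \<inter> V)) ?F"
        using smoothD[OF U(2) V, where k = "Suc k"] unfolding Ck_on.simps by (elim conjE allE)
    qed
    moreover have "?F ((\<phi> \<circ> inv_into W \<psi>) x) =
        apply_field (\<lambda>q. coord_tvec M A (V, \<phi>) q a) f (inv_into W \<psi> x)" if x: "x \<in> \<psi> ` (U \<inter> W)" for x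
    proof -
      obtain q where q: "q \<in> U" "q \<in> W" "x = \<psi> q" using x by auto
      have "smooth_near M A q f" unfolding smooth_near_def using U(2) q(1) by auto
      then show ?thesis
        unfolding apply_field_def coord_tvec_eq q(3) comp_def chart_inv[OF W q(2)]
        by (simp only: if_True)
    qed
    ultimately show "Ck_on k (\<psi> ` (U \<inter> W))
        (\<lambda>x. apply_field (\<lambda>q. coord_tvec M A (V, \<phi>) q a) f (inv_into W \<psi> x))"
      by (rule Ck_on_cong[OF chart_open[OF W oU], rotated])
  qed
qed

text \<open>The hypotheses on products and metrics speak of fields, whereas nondegeneracy speaks of single
  tangent vectors; extending vectors to local fields passes from one to the other.\<close>

lemma tangent_extend:
  assumes "p \<in> topspace M" "u \<in> T p"
  obtains U X where "p \<in> U" "VF U X" "X p = u"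
proof -
  obtain V \<phi> where V: "(V, \<phi>) \<in> A" "p \<in> V" using chart_cover[OF assms(1)] by blast
  then obtain a where "u = coord_tvec M A (V, \<phi>) p a"
    using assms(2) tangent_space_chart by auto
  then show ?thesis using that VF_coord[OF V(1)] V(2) by blast
qed

lemma VF_restrict: "VF (topspace M) X \<Longrightarrow> VF U Y \<Longrightarrow> VF U X"
  by (rule VF_subset[OF _ VF_openin openin_subset[OF VF_openin]])

lemma conn_VF: "connection M A N \<Longrightarrow> VF U X \<Longrightarrow> VF U Y \<Longrightarrow> VF U (N X Y)"
  by (simp add: connection_def)

lemma conn_cong:
  assumes "connection M A N" "VF U X" "VF U Y" "eq_on U X X'" "eq_on U Y Y'"
  shows "eq_on U (N X Y) (N X' Y')"
  using assms(1) assms(2-5) VF_cong[OF assms(2,4)] VF_cong[OF assms(3,5)]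
  unfolding connection_def by (elim conjE) metis

lemma eq_on_trans: "eq_on U X Y \<Longrightarrow> eq_on U Y Z \<Longrightarrow> eq_on U X Z"
  and eq_on_sym: "eq_on U X Y \<Longrightarrow> eq_on U Y X"
  and eq_on_refl: "eq_on U X X"
  by (simp_all add: eq_on_def)

lemma vadd_cong: "eq_on U X X' \<Longrightarrow> eq_on U Y Y' \<Longrightarrow> eq_on U (vadd X Y) (vadd X' Y')"
  and vscale_cong: "eq_on U X X' \<Longrightarrow> eq_on U (vscale h X) (vscale h X')"
  by (simp_all add: eq_on_def vadd_def vscale_def)

lemma common_fields:
  assumes "p \<in> U" "VF U X" "w \<in> T p"
  obtains V W where "openin M V" "V \<subseteq> U" "p \<in> V" "VF V W" "W p = w"
proof -
  obtain V W where V: "p \<in> V" "VF V W" "W p = w"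
    using tangent_extend[OF VF_point[OF assms(2,1)] assms(3)] .
  have o: "openin M (U \<inter> V)" using VF_openin[OF assms(2)] VF_openin[OF V(2)] by (rule openin_Int)
  show ?thesis
    by (rule that[OF o _ _ VF_subset[OF V(2) o]]) (use V assms(1) in auto)
qed

end

section \<open>Metrics and their Levi-Civita connections\<close>

locale metric_connection = atlas M A
  for M :: "'a topology" and A :: "('a, 'e::euclidean_space) chart set" +
  fixes g :: "'a metric_field" and D :: "'a conn"
  assumes metric: "pseudo_riemannian_metric M A g" and lc: "levi_civita M A g D"
begin

lemma D_conn: "connection M A D" and D_torsionless: "torsionless M A D"
  using lc by (simp_all add: levi_civita_def)

lemmas D_VF = conn_VF[OF D_conn]
lemmas D_cong = conn_cong[OF D_conn]

lemma
  assumes "p \<in> topspace M" "u \<in> T p" "v \<in> T p" "w \<in> T p"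
  shows g_sym: "g p u v = g p v u"
    and g_tadd: "g p (tadd u v) w = g p u w + g p v w"
    and g_tscale: "g p (tscale r u) v = r * g p u v"
  using metric assms unfolding pseudo_riemannian_metric_def by simp_all

lemma g_eqI:
  assumes p: "p \<in> topspace M" and u: "u \<in> T p" and v: "v \<in> T p"
    and eq: "\<And>w. w \<in> T p \<Longrightarrow> g p u w = g p v w"
  shows "u = v"
proof -
  let ?d = "tadd u (tscale (- 1) v)"
  have d: "?d \<in> T p" using p u v by (intro tangent_tadd tangent_tscale)
  have "g p ?d w = 0" if w: "w \<in> T p" for w
    using g_tadd[OF p u tangent_tscale[OF p v] w] g_tscale[OF p v w w] eq[OF w] by simp
  then have "?d = tzero"
    using metric p d unfolding pseudo_riemannian_metric_def by blast
  then have "u f - v f = 0" for f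
    unfolding tadd_def tscale_def by (drule_tac fun_cong[where x = f]) simp
  then show ?thesis by (simp add: fun_eq_iff)
qed

text \<open>The torsion identity and the uniqueness of the associated connection are proved in this way: after
  pairing with a test field, brackets, exterior derivatives and Lie derivatives become linear
  expressions in the numbers \<open>g(D\<^sub>X Y, Z)\<close>.  A tangent vector is known to extend to a field near
  its base point only, hence the smaller domain.\<close>

lemma eq_onI:
  assumes X: "VF U X" and Y: "VF U Y"
    and eq: "\<And>V W p. openin M V \<Longrightarrow> V \<subseteq> U \<Longrightarrow> VF V W \<Longrightarrow> p \<in> V \<Longrightarrow> tens g X W p = tens g Y W p"
  shows "eq_on U X Y"
  unfolding eq_on_def
proof
  fix p assume p: "p \<in> U"
  show "X p = Y p"
  proof (rule g_eqI[OF VF_point[OF X p] VF_tangent[OF X p] VF_tangent[OF Y p]])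
    fix w assume "w \<in> T p"
    then obtain V W where "openin M V" "V \<subseteq> U" "p \<in> V" "VF V W" "W p = w"
      using common_fields[OF p X] by blast
    then show "g p (X p) w = g p (Y p) w" using eq[of V W p] by (simp add: tens_def)
  qed
qed

lemma g_field_sym: "VF U X \<Longrightarrow> VF U Y \<Longrightarrow> p \<in> U \<Longrightarrow> tens g X Y p = tens g Y X p"
  unfolding tens_def using g_sym[OF VF_point VF_tangent VF_tangent VF_tangent] .

lemma g_vadd:
  "VF U X \<Longrightarrow> VF U Y \<Longrightarrow> VF U Z \<Longrightarrow> p \<in> U \<Longrightarrow>
    tens g (vadd X Y) Z p = tens g X Z p + tens g Y Z p"
  unfolding tens_def vadd_def using g_tadd[OF VF_point VF_tangent VF_tangent VF_tangent] .

lemma g_vscale: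
  "VF U X \<Longrightarrow> VF U Y \<Longrightarrow> p \<in> U \<Longrightarrow> tens g (vscale h X) Y p = h p * tens g X Y p"
  unfolding tens_def vscale_def using g_tscale[OF VF_point VF_tangent VF_tangent VF_tangent] .

lemma g_vminus:
  assumes "VF U X" "VF U Y" "VF U Z" "p \<in> U"
  shows "tens g (vminus X Y) Z p = tens g X Z p - tens g Y Z p"
  using g_vadd[OF assms(1) VF_vscale[OF assms(2) smooth_const[OF VF_openin[OF assms(2)]]] assms(3,4)]
    g_vscale[OF assms(2-4)] by simp

lemma g_cong: "X p = X' p \<Longrightarrow> Y p = Y' p \<Longrightarrow> tens g X Y p = tens g X' Y' p"
  by (simp add: tens_def)

lemma bracket_eq: "VF U X \<Longrightarrow> VF U Y \<Longrightarrow> eq_on U (vminus (D X Y) (D Y X)) (bracket X Y)"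
  using D_torsionless by (simp add: torsionless_def)

text \<open>Torsion-freeness expresses the bracket by the connection, whose values are vector fields; this
  replaces a computation in coordinates.\<close>

lemma bracket_VF: "VF U X \<Longrightarrow> VF U Y \<Longrightarrow> VF U (bracket X Y)"
  using VF_cong[OF VF_vminus[OF D_VF D_VF] bracket_eq] .

lemma g_bracket:
  assumes "VF U X" "VF U Y" "VF U Z" "p \<in> U"
  shows "tens g (bracket X Y) Z p = tens g (D X Y) Z p - tens g (D Y X) Z p"
proof -
  have "tens g (bracket X Y) Z p = tens g (vminus (D X Y) (D Y X)) Z p"
    using bracket_eq[OF assms(1,2)] assms(4) by (simp add: eq_on_def tens_def)
  then show ?thesis
    using g_vminus[OF D_VF[OF assms(1,2)] D_VF[OF assms(2,1)] assms(3,4)] by simp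
qed

lemma D_metric:
  assumes "VF U X" "VF U Y" "VF U Z" "p \<in> U"
  shows "apply_field X (tens g Y Z) p = tens g (D X Y) Z p + tens g (D X Z) Y p"
proof -
  have "cov_deriv_metric D g X Y Z p = 0"
    using lc assms unfolding levi_civita_def by blast
  then show ?thesis
    using g_field_sym[OF assms(2) D_VF[OF assms(1,3)] assms(4)]
    by (simp add: cov_deriv_metric_def)
qed

lemma apply_field_cong:
  assumes "VF U X" "p \<in> U" "\<And>q. q \<in> U \<Longrightarrow> f q = f' q"
  shows "apply_field X f p = apply_field X f' p"
  unfolding apply_field_def
  by (rule tangent_local[OF VF_tangent[OF assms(1,2)] VF_openin[OF assms(1)] assms(2,3)])

lemma D_metric_cong:
  assumes X: "VF U X" and Y: "VF U Y" "VF U Z" and Y': "VF U Y'" "VF U Z'" and p: "p \<in> U"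
    and eq: "\<And>q. q \<in> U \<Longrightarrow> tens g Y Z q = tens g Y' Z' q"
  shows "tens g (D X Y) Z p + tens g (D X Z) Y p = tens g (D X Y') Z' p + tens g (D X Z') Y' p"
  using D_metric[OF X Y p] D_metric[OF X Y' p] apply_field_cong[OF X p eq] by simp

lemma killing_expand:
  assumes e: "VF U e" and Y: "VF U Y" and Z: "VF U Z" and p: "p \<in> U"
  shows "apply_field e (tens g Y Z) p - tens g (bracket e Y) Z p - tens g Y (bracket e Z) p =
    tens g (D Y e) Z p + tens g (D Z e) Y p"
  using D_metric[OF e Y Z p] g_bracket[OF e Y Z p] g_bracket[OF e Z Y p]
    g_field_sym[OF Y bracket_VF[OF e Z] p] by simp

text \<open>The Killing equation for \<open>e\<close> says that the endomorphism \<open>Y \<mapsto> D\<^sub>Y e\<close> is skew.  In this form it can be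
  verified for a new metric from its Levi-Civita connection alone.\<close>

lemma killing_iff:
  assumes e: "VF (topspace M) e"
  shows "killing M A g e \<longleftrightarrow>
    (\<forall>U Y Z. VF U Y \<and> VF U Z \<longrightarrow> (\<forall>p\<in>U. tens g (D Y e) Z p + tens g (D Z e) Y p = 0))"
proof -
  have "apply_field e (tens g Y Z) p - tens g (bracket e Y) Z p - tens g Y (bracket e Z) p =
      tens g (D Y e) Z p + tens g (D Z e) Y p"
    if "VF U Y \<and> VF U Z" "p \<in> U" for U Y Z p
    using that by (intro killing_expand[of U] VF_restrict[OF e, of U Y]) auto
  then show ?thesis unfolding killing_def by (simp cong: ball_cong)
qed

lemma d_theta_expand:
  assumes e: "VF U e" and Y: "VF U Y" and Z: "VF U Z" and p: "p \<in> U"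
  shows "d_theta M A g e Y Z p = tens g (D Y e) Z p - tens g (D Z e) Y p"
  using D_metric[OF Y e Z p] D_metric[OF Z e Y p] g_bracket[OF Y Z e p]
    g_field_sym[OF e bracket_VF[OF Y Z] p] by (simp add: d_theta_def)

lemma riemann_VF: "VF U X \<Longrightarrow> VF U Y \<Longrightarrow> VF U Z \<Longrightarrow> VF U (riemann_tensor M A D X Y Z)"
  unfolding riemann_tensor_def by (intro VF_vminus D_VF bracket_VF)

lemma riemann_cong:
  assumes X: "VF U X" and Y: "VF U Y" and Z: "VF U Z" and eq: "eq_on U Z Z'"
  shows "eq_on U (riemann_tensor M A D X Y Z) (riemann_tensor M A D X Y Z')"
  unfolding riemann_tensor_def
  by (intro vadd_cong vscale_cong D_cong D_VF bracket_VF eq_on_refl X Y Z eq)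

end

section \<open>F-manifolds\<close>

locale unital_F_manifold = atlas M A
  for M :: "'a topology" and A :: "('a, 'e::euclidean_space) chart set" +
  fixes c :: "'a prod_field" and e :: "'a vfield"
  assumes F: "F_manifold M A c e"
begin

lemma tensor: "product_tensor M A c"
  using F unfolding F_manifold_def by (elim conjE)

lemma e_global: "VF (topspace M) e"
  using F unfolding F_manifold_def by (elim conjE)

lemmas e_VF = VF_restrict[OF e_global]

lemma c_VF: "VF U X \<Longrightarrow> VF U Y \<Longrightarrow> VF U (tens c X Y)"
  using tensor by (simp add: product_tensor_def)

lemma
  assumes "p \<in> topspace M" "u \<in> T p" "v \<in> T p" "w \<in> T p"
  shows c_closed: "c p u v \<in> T p"
    and c_tadd: "c p u (tadd v w) = tadd (c p u v) (c p u w)"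
    and c_tscale: "c p u (tscale r v) = tscale r (c p u v)"
  using tensor assms unfolding product_tensor_def by simp_all

lemma
  assumes p: "p \<in> topspace M" and u: "u \<in> T p" and v: "v \<in> T p" and w: "w \<in> T p"
  shows c_commute: "c p u v = c p v u"
    and c_assoc: "c p (c p u v) w = c p u (c p v w)"
    and c_unit: "c p (e p) u = u"
proof -
  obtain U X where X: "p \<in> U" "VF U X" "X p = u" using tangent_extend[OF p u] .
  obtain V Y where Y: "openin M V" "V \<subseteq> U" "p \<in> V" "VF V Y" "Y p = v"
    using common_fields[OF X(1,2) v] .
  obtain W Z where Z: "openin M W" "W \<subseteq> V" "p \<in> W" "VF W Z" "Z p = w"
    using common_fields[OF Y(3,4) w] .
  have W: "VF W X" "VF W Y"
    using VF_subset[OF X(2) Z(1)] VF_subset[OF Y(4) Z(1)] Y(2) Z(2) by auto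
  have comm: "eq_on W (tens c X Y) (tens c Y X)"
    using F W unfolding F_manifold_def by (elim conjE) simp
  have assoc: "eq_on W (tens c (tens c X Y) Z) (tens c X (tens c Y Z))"
    using F W Z(4) unfolding F_manifold_def by (elim conjE) simp
  have unit: "eq_on W (tens c e X) X"
    using F W unfolding F_manifold_def by (elim conjE) simp
  note at_p = eq_on_def tens_def
  show "c p u v = c p v u" "c p (c p u v) w = c p u (c p v w)" "c p (e p) u = u"
    using comm[unfolded at_p, THEN bspec, OF Z(3)] assoc[unfolded at_p, THEN bspec, OF Z(3)]
      unit[unfolded at_p, THEN bspec, OF Z(3)]
    unfolding X(3) Y(5) Z(5) .
qed

lemma c_field_commute: "VF U X \<Longrightarrow> VF U Y \<Longrightarrow> eq_on U (tens c X Y) (tens c Y X)"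
  unfolding eq_on_def tens_def using c_commute[OF VF_point VF_tangent VF_tangent VF_tangent] by blast

lemma c_field_assoc:
  "VF U X \<Longrightarrow> VF U Y \<Longrightarrow> VF U Z \<Longrightarrow> eq_on U (tens c (tens c X Y) Z) (tens c X (tens c Y Z))"
  unfolding eq_on_def tens_def using c_assoc[OF VF_point VF_tangent VF_tangent VF_tangent] by blast

lemma c_field_unit: "VF U X \<Longrightarrow> eq_on U (tens c e X) X"
  unfolding eq_on_def tens_def using c_unit[OF VF_point VF_tangent VF_tangent VF_tangent] by blast

lemma c_left_commute:
  assumes X: "VF U X" and Y: "VF U Y" and Z: "VF U Z"
  shows "eq_on U (tens c X (tens c Y Z)) (tens c Y (tens c X Z))"
proof -
  have "eq_on U (tens c (tens c X Y) Z) (tens c (tens c Y X) Z)"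
    using c_field_commute[OF X Y] by (simp add: eq_on_def tens_def)
  from eq_on_trans[OF eq_on_sym[OF c_field_assoc[OF X Y Z]] this] c_field_assoc[OF Y X Z]
  show ?thesis by (rule eq_on_trans)
qed

lemma c_field_cong: "eq_on U Y Z \<Longrightarrow> eq_on U (tens c X Y) (tens c X Z)"
  by (simp add: eq_on_def tens_def)

lemma c_field_vadd:
  assumes "VF U X" "VF U Y" "VF U Z"
  shows "eq_on U (tens c X (vadd Y Z)) (vadd (tens c X Y) (tens c X Z))"
  unfolding eq_on_def tens_def vadd_def
  by (intro ballI c_tadd[OF VF_point[OF assms(1)] assms[THEN VF_tangent]])

lemma c_field_vscale:
  assumes "VF U X" "VF U Y"
  shows "eq_on U (tens c X (vscale h Y)) (vscale h (tens c X Y))"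
  unfolding eq_on_def tens_def vscale_def
  by (intro ballI c_tscale[OF VF_point[OF assms(1)] assms(1,2,2)[THEN VF_tangent]])

lemma c_field_vminus:
  assumes X: "VF U X" and Y: "VF U Y" and Z: "VF U Z"
  shows "eq_on U (tens c X (vminus Y Z)) (vminus (tens c X Y) (tens c X Z))"
  using c_field_vadd[OF X Y VF_vscale[OF Z smooth_const[OF VF_openin[OF Z]]]]
    c_field_vscale[OF X Z, of "\<lambda>p. - 1"]
  by (simp add: eq_on_def vadd_def)

lemma F_identity:
  assumes "VF U X" "VF U Y" "VF U Z" "VF U W"
  shows "eq_on U (lie_deriv_prod M A c (tens c X Y) Z W)
    (vadd (tens c X (lie_deriv_prod M A c Y Z W)) (tens c Y (lie_deriv_prod M A c X Z W)))"
  using F assms unfolding F_manifold_def by (elim conjE) simp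

end

section \<open>Invariant metrics\<close>

locale invariant_metric = metric_connection M A g D + unital_F_manifold M A c e
  for M :: "'a topology" and A :: "('a, 'e::euclidean_space) chart set"
    and g :: "'a metric_field" and D :: "'a conn" and c :: "'a prod_field" and e :: "'a vfield" +
  assumes invariant: "\<And>U X Y Z p. VF U X \<Longrightarrow> VF U Y \<Longrightarrow> VF U Z \<Longrightarrow> p \<in> U \<Longrightarrow>
    tens g (tens c X Y) Z p = tens g X (tens c Y Z) p"
begin

lemma D_product_commute:
  assumes "VF U X" "VF U Y" "VF U W" "p \<in> U"
  shows "tens g (D W (tens c X Y)) Z p = tens g (D W (tens c Y X)) Z p"
  using D_cong[OF assms(3) c_VF[OF assms(1,2)] _ c_field_commute[OF assms(1,2)], of W] assms(4)
  by (simp add: eq_on_def tens_def)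

lemma D_product_direction:
  assumes "VF U X" "VF U Y" "VF U W" "p \<in> U"
  shows "tens g (D (tens c X Y) W) Z p = tens g (D (tens c Y X) W) Z p"
  using D_cong[OF c_VF[OF assms(1,2)] assms(3) c_field_commute[OF assms(1,2)], of W] assms(4)
  by (simp add: eq_on_def tens_def)

lemma g_product_commute:
  assumes "VF U X" "VF U Y" "p \<in> U"
  shows "tens g Z (tens c X Y) p = tens g Z (tens c Y X) p"
  using c_field_commute[OF assms(1,2)] assms(3) by (simp add: eq_on_def tens_def)

text \<open>The function \<open>g((D\<^sub>W c)(X,Y), Z)\<close>, where \<open>c\<close> is the product.  It is written with the argument of \<open>D\<close>
  on the left of \<open>g\<close> throughout, so that for fixed arguments it is a linear combination of the numbers
  \<open>g(D\<^sub>X Y, Z)\<close>.\<close>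

definition Dc :: "'a vfield \<Rightarrow> 'a vfield \<Rightarrow> 'a vfield \<Rightarrow> 'a vfield \<Rightarrow> 'a \<Rightarrow> real" where
  "Dc W X Y Z p = tens g (D W (tens c X Y)) Z p - tens g (D W X) (tens c Y Z) p
    - tens g (D W Y) (tens c X Z) p"

lemma Dc_swap12:
  assumes "VF U X" "VF U Y" "VF U W" "p \<in> U"
  shows "Dc W X Y Z p = Dc W Y X Z p"
  using D_product_commute[OF assms] by (simp add: Dc_def)

text \<open>Since \<open>D g = 0\<close> and \<open>g(X \<circ> Y, Z)\<close> is totally symmetric, so is \<open>D\<^sub>W c\<close> with its last index lowered.\<close>

lemma Dc_swap23:
  assumes X: "VF U X" and Y: "VF U Y" and Z: "VF U Z" and W: "VF U W" and p: "p \<in> U"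
  shows "Dc W X Y Z p = Dc W X Z Y p"
proof -
  have "tens g (tens c X Y) Z q = tens g (tens c X Z) Y q" if q: "q \<in> U" for q
    using invariant[OF Y X Z q] g_field_sym[OF Y c_VF[OF X Z] q] 
      g_cong[of "tens c X Y" q "tens c Y X" Z Z] c_field_commute[OF X Y] q
    by (simp add: eq_on_def)
  then have "tens g (D W (tens c X Y)) Z p + tens g (D W Z) (tens c X Y) p
      = tens g (D W (tens c X Z)) Y p + tens g (D W Y) (tens c X Z) p"
    by (rule D_metric_cong[OF W c_VF[OF X Y] Z c_VF[OF X Z] Y p])
  then show ?thesis using g_product_commute[OF Y Z p, of "D W X"] by (simp add: Dc_def)
qed

lemma g_product_unit:
  assumes "VF U X" "VF U Y" "p \<in> U"
  shows "tens g (tens c X Y) e p = tens g X Y p"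
proof -
  have "tens c Y e p = Y p"
    using c_field_commute[OF assms(2) e_VF[OF assms(2)]] c_field_unit[OF assms(2)] assms(3)
    by (simp add: eq_on_def)
  then show ?thesis
    using invariant[OF assms(1,2) e_VF[OF assms(1)] assms(3)] g_cong[of X p X "tens c Y e" Y]
    by simp
qed

text \<open>With the index lowered, the product can be moved away from the brackets.\<close>

lemma g_lie_product:
  assumes X: "VF U X" and Y: "VF U Y" and Z: "VF U Z" and W: "VF U W" and p: "p \<in> U"
  shows "tens g (lie_deriv_prod M A c Y Z W) X p =
    tens g (bracket Y (tens c Z W)) X p - tens g (bracket Y Z) (tens c W X) p
      - tens g (bracket Y W) (tens c Z X) p"
proof -
  note V = bracket_VF[OF Y c_VF[OF Z W]] bracket_VF[OF Y Z] bracket_VF[OF Y W]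
  have "tens g (tens c Z (bracket Y W)) X p = tens g (tens c (bracket Y W) Z) X p"
    using c_field_commute[OF Z V(3)] p by (intro g_cong) (auto simp: eq_on_def)
  then show ?thesis
    unfolding lie_deriv_prod_def
    using g_vminus[OF V(1) c_VF[OF V(2) W] X p]
      g_vminus[OF VF_vminus[OF V(1) c_VF[OF V(2) W]] c_VF[OF Z V(3)] X p]
      invariant[OF V(2) W X p] invariant[OF V(3) Z X p]
    by simp
qed

lemma lie_product_VF:
  assumes Y: "VF U Y" and Z: "VF U Z" and W: "VF U W"
  shows "VF U (lie_deriv_prod M A c Y Z W)"
  unfolding lie_deriv_prod_def by (intro VF_vminus bracket_VF c_VF assms)

text \<open>Pairing with the unit turns \<open>g(X \<circ> V, e)\<close> into \<open>g(V, X)\<close>, so that on the right-hand side of the identity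
  defining F-manifolds no product of a field with a Lie derivative remains.\<close>

lemma F_identity_unit:
  assumes X: "VF U X" and Y: "VF U Y" and Z: "VF U Z" and W: "VF U W" and p: "p \<in> U"
  shows "tens g (lie_deriv_prod M A c (tens c X Y) Z W) e p =
    tens g (lie_deriv_prod M A c Y Z W) X p + tens g (lie_deriv_prod M A c X Z W) Y p"
proof -
  note V = lie_product_VF[OF X Z W] lie_product_VF[OF Y Z W] and e = e_VF[OF X]
  have "tens g (lie_deriv_prod M A c (tens c X Y) Z W) e p =
      tens g (vadd (tens c X (lie_deriv_prod M A c Y Z W)) (tens c Y (lie_deriv_prod M A c X Z W))) e p"
    using F_identity[OF X Y Z W] p by (intro g_cong) (auto simp: eq_on_def)
  also have "\<dots> = tens g (tens c X (lie_deriv_prod M A c Y Z W)) e p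
      + tens g (tens c Y (lie_deriv_prod M A c X Z W)) e p"
    by (rule g_vadd[OF c_VF[OF X V(2)] c_VF[OF Y V(1)] e p])
  finally show ?thesis
    using g_product_unit[OF X V(2) p] g_product_unit[OF Y V(1) p]
      g_field_sym[OF X V(2) p] g_field_sym[OF Y V(1) p] by simp
qed

end

section \<open>Killing unit fields\<close>

locale killing_F_manifold = invariant_metric M A g D c e
  for M :: "'a topology" and A :: "('a, 'e::euclidean_space) chart set"
    and g :: "'a metric_field" and D :: "'a conn" and c :: "'a prod_field" and e :: "'a vfield" +
  assumes killing: "killing M A g e"
begin

text \<open>Up to a factor of 2 this is the exterior derivative of \<open>\<theta> = g(e, \<sqdot>)\<close>, because \<open>e\<close> is a Killing field.\<close>

abbreviation \<omega> :: "'a vfield \<Rightarrow> 'a vfield \<Rightarrow> 'a \<Rightarrow> real" where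
  "\<omega> X Y \<equiv> tens g (D X e) Y"

lemma \<omega>_skew: "VF U X \<Longrightarrow> VF U Y \<Longrightarrow> p \<in> U \<Longrightarrow> \<omega> X Y p + \<omega> Y X p = 0"
  using killing killing_iff[OF e_global] by blast

lemma d_theta_\<omega>: "VF U X \<Longrightarrow> VF U Y \<Longrightarrow> p \<in> U \<Longrightarrow> d_theta M A g e X Y p = 2 * \<omega> X Y p"
  using d_theta_expand[OF e_VF] \<omega>_skew by fastforce

text \<open>The contracted identity, with brackets and Lie derivatives expanded by \<open>D\<close>.  Derivatives along
  \<open>X \<circ> Y\<close> occur only in the combination \<open>g(Z \<circ> W, e) - g(Z, W) = 0\<close>, up to the term \<open>\<omega>(X \<circ> Y, Z \<circ> W)\<close>;
  likewise for derivatives along \<open>Z \<circ> W\<close>.\<close>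

lemma Dc_pairs:
  assumes X: "VF U X" and Y: "VF U Y" and Z: "VF U Z" and W: "VF U W" and p: "p \<in> U"
  shows "Dc Z X Y W p + Dc W X Y Z p - Dc X Z W Y p - Dc Y Z W X p
    = 2 * \<omega> (tens c X Y) (tens c Z W) p"
proof -
  note XY = c_VF[OF X Y] and ZW = c_VF[OF Z W] and e = e_VF[OF X]
  have A: "tens g (D (tens c X Y) (tens c Z W)) e p + \<omega> (tens c X Y) (tens c Z W) p =
      tens g (D (tens c X Y) Z) W p + tens g (D (tens c X Y) W) Z p"
    using g_product_unit[OF Z W] by (intro D_metric_cong[OF XY ZW e Z W p])
  have B: "tens g (D (tens c Z W) (tens c X Y)) e p + \<omega> (tens c Z W) (tens c X Y) p =
      tens g (D (tens c Z W) X) Y p + tens g (D (tens c Z W) Y) X p"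
    using g_product_unit[OF X Y] by (intro D_metric_cong[OF ZW XY e X Y p])
  have unit: "tens g V (tens c Z e) p = tens g V Z p" if "VF U Z" for V Z
    using c_field_commute[OF that e] c_field_unit[OF that] p by (intro g_cong) (auto simp: eq_on_def)
  \<comment> \<open>Products are first put into the order in which they occur in the goal; brackets are expanded after that.\<close>
  show ?thesis
    using F_identity_unit[OF X Y Z W p] A B \<omega>_skew[OF XY ZW p]
    unfolding g_lie_product[OF e XY Z W p] g_lie_product[OF X Y Z W p]
      g_lie_product[OF Y X Z W p] Dc_def unit[OF W] unit[OF Z]
      g_product_commute[OF W X p] g_product_commute[OF Z X p]
      g_product_commute[OF W Y p] g_product_commute[OF Z Y p]
      g_bracket[OF XY ZW e p] g_bracket[OF XY Z W p] g_bracket[OF XY W Z p]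
      g_bracket[OF Y ZW X p] g_bracket[OF X ZW Y p]
    unfolding g_bracket[OF Y Z c_VF[OF X W] p] g_bracket[OF Y W c_VF[OF X Z] p]
      g_bracket[OF X Z c_VF[OF Y W] p] g_bracket[OF X W c_VF[OF Y Z] p]
    by argo
qed

text \<open>Write \<open>a\<^sub>X\<close> for the value of \<^const>\<open>Dc\<close> differentiated along \<open>X\<close>; the order of the other three fields
  does not matter.  The previous lemma reads \<open>a\<^sub>Z + a\<^sub>W - a\<^sub>X - a\<^sub>Y = 2 \<omega>(X \<circ> Y, Z \<circ> W)\<close>, and adding the
  same equation with \<open>X\<close> and \<open>W\<close> exchanged isolates \<open>a\<^sub>Z - a\<^sub>Y\<close>.  So \<open>D c\<close> fails to be symmetric
  exactly by terms in \<open>d\<theta>\<close>.\<close>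

lemma Dc_exchange:
  assumes X: "VF U X" and Y: "VF U Y" and Z: "VF U Z" and W: "VF U W" and p: "p \<in> U"
  shows "Dc Z Y X W p - Dc Y Z X W p =
    \<omega> (tens c X Y) (tens c Z W) p + \<omega> (tens c W Y) (tens c Z X) p"
proof -
  have "Dc Z X Y W p = Dc Z Y X W p"
    by (rule Dc_swap12[OF X Y Z p])
  moreover have "Dc Z W Y X p = Dc Z Y X W p"
    unfolding Dc_swap12[OF W Y Z p] by (rule Dc_swap23[OF Y W X Z p])
  moreover have "Dc W Z X Y p = Dc W X Y Z p"
    unfolding Dc_swap12[OF Z X W p] by (rule Dc_swap23[OF X Z Y W p])
  moreover have "Dc X W Y Z p = Dc X Z W Y p"
    unfolding Dc_swap23[OF W Y Z X p] by (rule Dc_swap12[OF W Z X p])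
  moreover have "Dc Y Z W X p = Dc Y Z X W p"
    by (rule Dc_swap23[OF Z W X Y p])
  ultimately show ?thesis
    using Dc_pairs[OF X Y Z W p] Dc_pairs[OF W Y Z X p] by argo
qed

text \<open>In terms of the associated flat connection, the hypothesis on \<open>L\<close> is \<open>\<nabla>L = 0\<close>.  The difference of the
  two sides is a skew part of \<open>D c\<close> plus derivatives of \<open>L\<close>; by the preceding lemma and the
  hypothesis both are values of \<open>\<omega>\<close>, and they cancel.\<close>

lemma D_mult_torsion:
  assumes L: "VF U L" and DL: "\<And>Y. VF U Y \<Longrightarrow> eq_on U (D Y L) (D (tens c L Y) e)"
    and Y: "VF U Y" and Z: "VF U Z"
  shows "eq_on U (vminus (D Y (tens c L Z)) (D Z (tens c L Y))) (tens c L (bracket Y Z))"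
proof (rule eq_onI)
  show "VF U (vminus (D Y (tens c L Z)) (D Z (tens c L Y)))" "VF U (tens c L (bracket Y Z))"
    by (intro VF_vminus D_VF c_VF bracket_VF L Y Z)+
  fix V W p assume V: "openin M V" "V \<subseteq> U" and W: "VF V W" and p: "p \<in> V"
  have DL': "tens g (D S L) R p = \<omega> (tens c L S) R p" if "VF U S" for S R
    using DL[OF that] V(2) p by (intro g_cong) (auto simp: eq_on_def)
  note DL'Y = DL'[OF Y] and DL'Z = DL'[OF Z]
  note L = VF_subset[OF L V] and Y = VF_subset[OF Y V] and Z = VF_subset[OF Z V]
  have "tens g (tens c L (bracket Y Z)) W p = tens g (tens c (bracket Y Z) L) W p"
    using c_field_commute[OF L bracket_VF[OF Y Z]] p by (intro g_cong) (auto simp: eq_on_def)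
  then have b: "tens g (tens c L (bracket Y Z)) W p =
      tens g (D Y Z) (tens c L W) p - tens g (D Z Y) (tens c L W) p"
    unfolding invariant[OF bracket_VF[OF Y Z] L W p] g_bracket[OF Y Z c_VF[OF L W] p] .
  have "tens g (D Y (tens c L Z)) W p - tens g (D Z (tens c L Y)) W p - tens g (tens c L (bracket Y Z)) W p
    = Dc Y L Z W p - Dc Z L Y W p + \<omega> (tens c L Y) (tens c Z W) p - \<omega> (tens c L Z) (tens c Y W) p"
    unfolding b Dc_def DL'Y DL'Z by simp
  also have "\<dots> = Dc Y Z L W p - Dc Z Y L W p + \<omega> (tens c L Y) (tens c Z W) p - \<omega> (tens c L Z) (tens c Y W) p"
    using Dc_swap12[OF L Z Y p] Dc_swap12[OF L Y Z p] by simp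
  also have "\<dots> = 0"
    using Dc_exchange[OF L Z Y W p] \<omega>_skew[OF c_VF[OF W Z] c_VF[OF Y L] p]
      D_product_direction[OF Y L e_VF[OF L] p, of "tens c W Z"]
      g_product_commute[OF W Z p, of "D (tens c L Y) e"] by argo
  finally show "tens g (vminus (D Y (tens c L Z)) (D Z (tens c L Y))) W p = tens g (tens c L (bracket Y Z)) W p"
    using g_vminus[OF D_VF[OF Y c_VF[OF L Z]] D_VF[OF Z c_VF[OF L Y]] W p] by simp
qed

lemma D_shift_torsion:
  assumes N: "\<And>X Y. VF U X \<Longrightarrow> VF U Y \<Longrightarrow> eq_on U (N X Y) (vminus (D X Y) (D (tens c X Y) e))"
    and X: "VF U X" and Y: "VF U Y"
  shows "eq_on U (vminus (N X Y) (N Y X)) (bracket X Y)"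
proof -
  have "D (tens c X Y) e p = D (tens c Y X) e p" if "p \<in> U" for p
    using D_cong[OF c_VF[OF X Y] e_VF[OF X] c_field_commute[OF X Y], of e] that by (simp add: eq_on_def)
  then show ?thesis
    using N[OF X Y] N[OF Y X] bracket_eq[OF X Y]
    by (simp add: eq_on_def vadd_def vscale_def tadd_def tscale_def)
qed

text \<open>Because \<open>d\<theta> = 2\<omega>\<close>, the connection \<open>D\<^sub>X Y - D\<^bsub>X \<circ> Y\<^esub> e\<close> meets the two conditions.  It is the only one by the
  argument for the uniqueness of the Levi-Civita connection: the difference \<open>s\<close> to another solution, with
  its index lowered, is symmetric in its first two arguments and skew in the last two, hence zero.\<close>

lemma associated_flat_connection_iff:
  assumes conn: "connection M A N"
  shows "associated_flat_connection M A c g e N \<longleftrightarrow>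
    (\<forall>U X Y. VF U X \<and> VF U Y \<longrightarrow> eq_on U (N X Y) (vminus (D X Y) (D (tens c X Y) e)))"
proof
  assume "associated_flat_connection M A c g e N"
  then have torsion: "VF U P \<and> VF U Q \<Longrightarrow> eq_on U (vminus (N P Q) (N Q P)) (bracket P Q)"
    and deriv: "VF U P \<and> VF U Q \<and> VF U R \<Longrightarrow> \<forall>p\<in>U. cov_deriv_metric N g P Q R p =
      1/2 * d_theta M A g e (tens c P Q) R p + 1/2 * d_theta M A g e (tens c P R) Q p"
    for U P Q R
    unfolding associated_flat_connection_def torsionless_def by simp_all
  show "\<forall>U X Y. VF U X \<and> VF U Y \<longrightarrow> eq_on U (N X Y) (vminus (D X Y) (D (tens c X Y) e))"
  proof (intro allI impI, elim conjE)
    fix U X Y assume X: "VF U X" and Y: "VF U Y"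
    show "eq_on U (N X Y) (vminus (D X Y) (D (tens c X Y) e))"
    proof (rule eq_onI)
      show "VF U (N X Y)" by (rule conn_VF[OF conn X Y])
      show "VF U (vminus (D X Y) (D (tens c X Y) e))"
        by (intro VF_vminus D_VF c_VF X Y e_VF[OF X])
      fix V Z p assume V: "openin M V" "V \<subseteq> U" and Z: "VF V Z" and p: "p \<in> V"
      note X = VF_subset[OF X V] and Y = VF_subset[OF Y V]
      \<comment> \<open>The difference of the two sides with its index lowered.\<close>
      define s where "s P Q R = tens g (N P Q) R p - tens g (D P Q) R p + \<omega> (tens c P Q) R p" for P Q R
      have sym: "s P Q R = s Q P R" if P: "VF V P" and Q: "VF V Q" and R: "VF V R" for P Q R
      proof -
        have "eq_on V (vminus (N P Q) (N Q P)) (bracket P Q)"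
          by (rule torsion[OF conjI[OF P Q]])
        then have "tens g (vminus (N P Q) (N Q P)) R p = tens g (bracket P Q) R p"
          using p by (intro g_cong) (auto simp: eq_on_def)
        then show ?thesis
          using g_vminus[OF conn_VF[OF conn P Q] conn_VF[OF conn Q P] R p] g_bracket[OF P Q R p]
            D_product_direction[OF P Q e_VF[OF P] p, of R] by (simp add: s_def)
      qed
      have skew: "s P Q R + s P R Q = 0" if P: "VF V P" and Q: "VF V Q" and R: "VF V R" for P Q R
      proof -
        have "cov_deriv_metric N g P Q R p =
            1/2 * d_theta M A g e (tens c P Q) R p + 1/2 * d_theta M A g e (tens c P R) Q p"
          by (rule deriv[OF conjI[OF P conjI[OF Q R]], THEN bspec, OF p])
        then show ?thesis
          using D_metric[OF P Q R p] d_theta_\<omega>[OF c_VF[OF P Q] R p] d_theta_\<omega>[OF c_VF[OF P R] Q p]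
            g_field_sym[OF conn_VF[OF conn P R] Q p]
          by (simp add: s_def cov_deriv_metric_def)
      qed
      have "s X Y Z = 0"
        using sym[OF X Y Z] sym[OF Y Z X] sym[OF Z X Y] skew[OF X Y Z] skew[OF Y Z X] skew[OF Z X Y]
        by simp
      then show "tens g (N X Y) Z p = tens g (vminus (D X Y) (D (tens c X Y) e)) Z p"
        using g_vminus[OF D_VF[OF X Y] D_VF[OF c_VF[OF X Y] e_VF[OF X]] Z p] by (simp add: s_def)
    qed
  qed
next
  assume "\<forall>U X Y. VF U X \<and> VF U Y \<longrightarrow> eq_on U (N X Y) (vminus (D X Y) (D (tens c X Y) e))"
  then have N: "eq_on U (N X Y) (vminus (D X Y) (D (tens c X Y) e))" if "VF U X" "VF U Y" for U X Y
    using that by simp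
  have "torsionless M A N"
    unfolding torsionless_def by (intro allI impI, elim conjE, rule D_shift_torsion[OF N])
  moreover have deriv: "cov_deriv_metric N g X Y Z p =
      1/2 * d_theta M A g e (tens c X Y) Z p + 1/2 * d_theta M A g e (tens c X Z) Y p"
    if X: "VF U X" and Y: "VF U Y" and Z: "VF U Z" and p: "p \<in> U" for U X Y Z p
  proof -
    have gN: "tens g (N X P) Q p = tens g (D X P) Q p - \<omega> (tens c X P) Q p"
      if P: "VF U P" and Q: "VF U Q" for P Q
    proof -
      have "tens g (N X P) Q p = tens g (vminus (D X P) (D (tens c X P) e)) Q p"
        using N[OF X P] p by (intro g_cong) (auto simp: eq_on_def)
      then show ?thesis
        using g_vminus[OF D_VF[OF X P] D_VF[OF c_VF[OF X P] e_VF[OF X]] Q p] by simp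
    qed
    show ?thesis
      unfolding cov_deriv_metric_def D_metric[OF X Y Z p] g_field_sym[OF Y conn_VF[OF conn X Z] p]
        gN[OF Y Z] gN[OF Z Y] d_theta_\<omega>[OF c_VF[OF X Y] Z p] d_theta_\<omega>[OF c_VF[OF X Z] Y p]
      by simp
  qed
  ultimately show "associated_flat_connection M A c g e N"
    unfolding associated_flat_connection_def using conn
    by (intro conjI allI impI ballI; (elim conjE)?) (assumption | rule deriv)+
qed

end

section \<open>Multiplication by an invertible flat field\<close>

text \<open>Here \<open>K\<close> is the inverse of \<open>L\<close>.  The condition on \<open>D\<^sub>Y L\<close> is \<open>\<nabla>\<^sub>Y L = 0\<close> for the associated flat
  connection, rewritten by \<open>associated_flat_connection_iff\<close>.\<close>

locale flat_multiplier = killing_F_manifold M A g D c e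
  for M :: "'a topology" and A :: "('a, 'e::euclidean_space) chart set"
    and g :: "'a metric_field" and D :: "'a conn" and c :: "'a prod_field" and e :: "'a vfield" +
  fixes L K :: "'a vfield"
  assumes L_global: "VF (topspace M) L" and K_global: "VF (topspace M) K"
    and inverse: "eq_on (topspace M) (tens c L K) e"
    and D_L: "\<And>U Y. VF U Y \<Longrightarrow> eq_on U (D Y L) (D (tens c L Y) e)"
begin

lemmas L_VF = VF_restrict[OF L_global] and K_VF = VF_restrict[OF K_global]

lemma
  assumes p: "p \<in> topspace M" and u: "u \<in> T p"
  shows L_K: "c p (L p) (c p (K p) u) = u" and K_L: "c p (K p) (c p (L p) u) = u"
proof -
  note L = VF_tangent[OF L_global p] and K = VF_tangent[OF K_global p]
  have "c p (L p) (K p) = e p" using inverse p by (simp add: eq_on_def tens_def)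
  then show "c p (L p) (c p (K p) u) = u" "c p (K p) (c p (L p) u) = u"
    using c_assoc[OF p L K u] c_assoc[OF p K L u] c_commute[OF p K L u] c_unit[OF p u u u] by simp_all
qed

lemma L_K_field: "VF U Y \<Longrightarrow> eq_on U (tens c L (tens c K Y)) Y"
  unfolding eq_on_def tens_def
  using L_K[OF VF_point VF_tangent] by blast

lemma K_L_field: "VF U Y \<Longrightarrow> eq_on U (tens c K (tens c L Y)) Y"
  unfolding eq_on_def tens_def
  using K_L[OF VF_point VF_tangent] by blast

abbreviation gL :: "'a metric_field" where
  "gL \<equiv> \<lambda>p u v. g p (c p (L p) u) (c p (L p) v)"

definition conj_L :: "'a conn \<Rightarrow> 'a conn" where
  "conj_L N = (\<lambda>Y Z. tens c K (N Y (tens c L Z)))"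

lemma tens_gL: "tens gL Y Z = tens g (tens c L Y) (tens c L Z)"
  by (simp add: tens_def)

lemma gL_metric: "pseudo_riemannian_metric M A gL"
  unfolding pseudo_riemannian_metric_def
proof (intro conjI ballI allI impI)
  fix p u v w r assume p: "p \<in> topspace M" and u: "u \<in> T p" and v: "v \<in> T p" and w: "w \<in> T p"
  note L = VF_tangent[OF L_global p]
  note cL = c_closed[OF p L _ L]
  show "gL p u v = gL p v u" by (rule g_sym[OF p cL[OF u] cL[OF v] L])
  show "gL p (tadd u v) w = gL p u w + gL p v w"
    unfolding c_tadd[OF p L u v] by (rule g_tadd[OF p cL[OF u] cL[OF v] cL[OF w]])
  show "gL p (tscale r u) v = r * gL p u v"
    unfolding c_tscale[OF p L u u] by (rule g_tscale[OF p cL[OF u] cL[OF v] L])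
next
  fix p u assume p: "p \<in> topspace M" and u: "u \<in> T p" and zero: "\<forall>v\<in>T p. gL p u v = 0"
  note L = VF_tangent[OF L_global p] and K = VF_tangent[OF K_global p]
  have cT: "c p (L p) u \<in> T p" by (rule c_closed[OF p L u u])
  have tz: "tscale 0 v = tzero" for v :: "'a tvec" by (simp add: tscale_def)
  \<comment> \<open>Writing the zero vector as a multiple makes linearity of the product and the metric applicable.\<close>
  have "c p (L p) u = tscale 0 u"
  proof (rule g_eqI[OF p cT tangent_tscale[OF p u]])
    fix w assume w: "w \<in> T p"
    have "g p (c p (L p) u) w = 0"
      using zero[THEN bspec, OF c_closed[OF p K w w]] unfolding L_K[OF p w] .
    then show "g p (c p (L p) u) w = g p (tscale 0 u) w"
      unfolding g_tscale[OF p u w w] by simp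
  qed
  then have "u = tscale 0 (c p (K p) u)"
    using K_L[OF p u] c_tscale[OF p K u u, of 0] by simp
  then show "u = tzero" by (simp only: tz)
next
  fix U X Y assume "VF U X \<and> VF U Y"
  then have "VF U X" "VF U Y" by simp_all
  then have "VF U (tens c L X) \<and> VF U (tens c L Y)" by (intro conjI c_VF L_VF)
  then show "smooth U (tens gL X Y)"
    using metric unfolding tens_gL pseudo_riemannian_metric_def by simp
qed

lemma conj_L_conn:
  assumes N: "connection M A N" shows "connection M A (conj_L N)"
proof -
  note N_VF = conn_VF[OF N] and N_cong = conn_cong[OF N]
  have add: "eq_on U (N (vadd X Y) Z) (vadd (N X Z) (N Y Z))"
      "eq_on U (N X (vadd Y Z)) (vadd (N X Y) (N X Z))"
    if "VF U X" "VF U Y" "VF U Z" for U X Y Z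
    using N that unfolding connection_def by simp_all
  have scale: "eq_on U (N (vscale h X) Y) (vscale h (N X Y))"
      "eq_on U (N X (vscale h Y)) (vadd (vscale (apply_field X h) Y) (vscale h (N X Y)))"
    if "VF U X" "VF U Y" "smooth U h" for U X Y h
    using N that unfolding connection_def by simp_all
  show ?thesis
    unfolding connection_def conj_L_def
  proof (intro conjI allI impI; (elim conjE)?)
    fix U X Y assume X: "VF U X" and Y: "VF U Y"
    show "VF U (tens c K (N X (tens c L Y)))"
      by (intro c_VF N_VF X Y K_VF[OF X] L_VF[OF X])
  next
    fix U X X' Y Y' assume X: "VF U X" and Y: "VF U Y" and eq: "eq_on U X X'" "eq_on U Y Y'"
    show "eq_on U (tens c K (N X (tens c L Y))) (tens c K (N X' (tens c L Y')))"
      by (intro c_field_cong N_cong c_VF X Y L_VF[OF X] eq)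
  next
    fix U X Y Z assume X: "VF U X" and Y: "VF U Y" and Z: "VF U Z"
    note K = K_VF[OF X] and LY = c_VF[OF L_VF[OF X] Y]
      and LZ = c_VF[OF L_VF[OF X] Z]
    show "eq_on U (tens c K (N (vadd X Y) (tens c L Z)))
        (vadd (tens c K (N X (tens c L Z))) (tens c K (N Y (tens c L Z))))"
      by (rule eq_on_trans[OF c_field_cong[OF add(1)[OF X Y LZ]]
            c_field_vadd[OF K N_VF[OF X LZ] N_VF[OF Y LZ]]])
    have "eq_on U (N X (tens c L (vadd Y Z))) (N X (vadd (tens c L Y) (tens c L Z)))"
      by (rule N_cong[OF X c_VF[OF L_VF[OF X] VF_vadd[OF Y Z]] eq_on_refl
            c_field_vadd[OF L_VF[OF X] Y Z]])
    from eq_on_trans[OF this add(2)[OF X LY LZ]]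
    show "eq_on U (tens c K (N X (tens c L (vadd Y Z))))
        (vadd (tens c K (N X (tens c L Y))) (tens c K (N X (tens c L Z))))"
      by (rule eq_on_trans[OF c_field_cong c_field_vadd[OF K N_VF[OF X LY] N_VF[OF X LZ]]])
  next
    fix U X Y h assume X: "VF U X" and Y: "VF U Y" and h: "smooth U h"
    note K = K_VF[OF X] and LY = c_VF[OF L_VF[OF X] Y]
    show "eq_on U (tens c K (N (vscale h X) (tens c L Y))) (vscale h (tens c K (N X (tens c L Y))))"
      by (rule eq_on_trans[OF c_field_cong[OF scale(1)[OF X LY h]] c_field_vscale[OF K N_VF[OF X LY]]])
    have "eq_on U (N X (tens c L (vscale h Y))) (N X (vscale h (tens c L Y)))"
      by (rule N_cong[OF X c_VF[OF L_VF[OF X] VF_vscale[OF Y h]] eq_on_refl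
            c_field_vscale[OF L_VF[OF X] Y]])
    from eq_on_trans[OF this scale(2)[OF X LY h]]
    have "eq_on U (tens c K (N X (tens c L (vscale h Y))))
        (vadd (tens c K (vscale (apply_field X h) (tens c L Y))) (tens c K (vscale h (N X (tens c L Y)))))"
      by (rule eq_on_trans[OF c_field_cong c_field_vadd[OF K VF_vscale[OF LY VF_smooth[OF X h]]
              VF_vscale[OF N_VF[OF X LY] h]]])
    moreover have "eq_on U (tens c K (vscale (apply_field X h) (tens c L Y))) (vscale (apply_field X h) Y)"
      by (rule eq_on_trans[OF c_field_vscale[OF K LY] vscale_cong[OF K_L_field[OF Y]]])
    ultimately show "eq_on U (tens c K (N X (tens c L (vscale h Y))))
        (vadd (vscale (apply_field X h) Y) (vscale h (tens c K (N X (tens c L Y)))))"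
      using c_field_vscale[OF K N_VF[OF X LY]] by (rule eq_on_trans[OF _ vadd_cong])
  qed
qed

text \<open>Compatibility with the new metric is immediate from the form of both; the torsion vanishes
  by \<open>D_mult_torsion\<close>, that is, by the F-manifold identity.\<close>

lemma conj_L_levi_civita: "levi_civita M A gL (conj_L D)"
  unfolding levi_civita_def torsionless_def
proof (intro conjI allI impI ballI; (elim conjE)?)
  show "connection M A (conj_L D)" by (rule conj_L_conn[OF D_conn])
next
  fix U X Y assume X: "VF U X" and Y: "VF U Y"
  note K = K_VF[OF X] and L = L_VF[OF X]
  note V = D_VF[OF X c_VF[OF L Y]] D_VF[OF Y c_VF[OF L X]]
  show "eq_on U (vminus (conj_L D X Y) (conj_L D Y X)) (bracket X Y)"
    unfolding conj_L_def
    by (rule eq_on_trans[OF eq_on_sym[OF c_field_vminus[OF K V]]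
          eq_on_trans[OF c_field_cong[OF D_mult_torsion[OF L D_L X Y]] K_L_field[OF bracket_VF[OF X Y]]]])
next
  fix U X Y Z p assume X: "VF U X" and Y: "VF U Y" and Z: "VF U Z" and p: "p \<in> U"
  note L = L_VF[OF X]
  note LY = c_VF[OF L Y] and LZ = c_VF[OF L Z]
  have "tens g (tens c L (tens c K (D X P))) Q p = tens g (D X P) Q p" if "VF U P" for P Q
    using L_K_field[OF D_VF[OF X that]] p by (intro g_cong) (simp_all add: eq_on_def)
  moreover have "tens g Q (tens c L (tens c K (D X P))) p = tens g Q (D X P) p" if "VF U P" for P Q
    using L_K_field[OF D_VF[OF X that]] p by (intro g_cong) (simp_all add: eq_on_def)
  ultimately show "cov_deriv_metric (conj_L D) gL X Y Z p = 0"
    using D_metric[OF X LY LZ p] LY LZ g_field_sym[OF LY D_VF[OF X LZ] p]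
    unfolding cov_deriv_metric_def tens_gL conj_L_def by simp
qed

sublocale L: metric_connection M A gL "conj_L D"
  by unfold_locales (rule gL_metric, rule conj_L_levi_civita)

sublocale L: invariant_metric M A gL "conj_L D" c e
proof unfold_locales
  fix U X Y Z p assume X: "VF U X" and Y: "VF U Y" and Z: "VF U Z" and p: "p \<in> U"
  note L = L_VF[OF X]
  have "tens g (tens c L (tens c X Y)) (tens c L Z) p = tens g (tens c (tens c L X) Y) (tens c L Z) p"
    using c_field_assoc[OF L X Y] p by (intro g_cong) (simp_all add: eq_on_def)
  also have "\<dots> = tens g (tens c L X) (tens c Y (tens c L Z)) p"
    by (rule invariant[OF c_VF[OF L X] Y c_VF[OF L Z] p])
  also have "\<dots> = tens g (tens c L X) (tens c L (tens c Y Z)) p"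
    using c_left_commute[OF Y L Z] p by (intro g_cong) (simp_all add: eq_on_def)
  finally show "tens gL (tens c X Y) Z p = tens gL X (tens c Y Z) p"
    by (simp only: tens_gL)
qed

lemma D_L_unit:
  assumes "VF U Y" shows "eq_on U (D Y (tens c L e)) (D (tens c L Y) e)"
proof -
  have "eq_on U (tens c L e) L"
    by (rule eq_on_trans[OF c_field_commute c_field_unit]) (intro L_VF[OF assms] e_VF[OF assms])+
  then have "eq_on U (D Y (tens c L e)) (D Y L)"
    by (rule D_cong[OF assms c_VF[OF L_VF[OF assms] e_VF[OF assms]] eq_on_refl])
  then show ?thesis using D_L[OF assms] by (rule eq_on_trans)
qed

text \<open>The endomorphism belonging to the new metric is \<open>Y \<mapsto> L\<^sup>-\<^sup>1 \<circ> D\<^bsub>L \<circ> Y\<^esub> e\<close>; under \<open>L\<close> its skewness becomes that of \<open>\<omega>\<close>.\<close>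

lemma gL_killing: "killing M A gL e"
  unfolding L.killing_iff[OF e_global]
proof (intro allI impI ballI, elim conjE)
  fix U Y Z p assume Y: "VF U Y" and Z: "VF U Z" and p: "p \<in> U"
  have *: "tens gL (conj_L D P e) Q p = \<omega> (tens c L P) (tens c L Q) p" if P: "VF U P" for P Q
  proof -
    have "eq_on U (tens c L (tens c K (D P (tens c L e)))) (D (tens c L P) e)"
      by (rule eq_on_trans[OF L_K_field[OF D_VF[OF P c_VF[OF L_VF[OF P] e_VF[OF P]]]] D_L_unit[OF P]])
    then show ?thesis
      unfolding tens_gL conj_L_def using p by (intro g_cong) (simp_all add: eq_on_def)
  qed
  show "tens gL (conj_L D Y e) Z p + tens gL (conj_L D Z e) Y p = 0"
    unfolding *[OF Y] *[OF Z]
    by (rule \<omega>_skew[OF c_VF[OF L_VF[OF Y] Y] c_VF[OF L_VF[OF Y] Z] p])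
qed

sublocale L: killing_F_manifold M A gL "conj_L D" c e
  by unfold_locales (rule gL_killing)

text \<open>By the characterization of associated flat connections for both metrics, it suffices to
  conjugate the equation \<open>N\<^sub>X Y = D\<^sub>X Y - D\<^bsub>X \<circ> Y\<^esub> e\<close> by \<open>L\<close>.  In its last term
  \<open>D\<^bsub>X \<circ> L \<circ> Y\<^esub> e = D\<^bsub>X \<circ> Y\<^esub> L = D\<^bsub>X \<circ> Y\<^esub> (L \<circ> e)\<close>.\<close>

lemma conj_L_associated:
  assumes N: "associated_flat_connection M A c g e N"
  shows "associated_flat_connection M A c gL e (conj_L N)"
proof -
  have conn: "connection M A N" using N by (simp add: associated_flat_connection_def)
  have N': "eq_on U (N X Y) (vminus (D X Y) (D (tens c X Y) e))" if "VF U X" "VF U Y" for U X Y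
    using N that unfolding associated_flat_connection_iff[OF conn] by simp
  show ?thesis
    unfolding L.associated_flat_connection_iff[OF conj_L_conn[OF conn]]
  proof (intro allI impI, elim conjE)
    fix U X Y assume X: "VF U X" and Y: "VF U Y"
    note L = L_VF[OF X] and K = K_VF[OF X] and e = e_VF[OF X]
    note LY = c_VF[OF L Y] and XY = c_VF[OF X Y]
    have "eq_on U (D (tens c X (tens c L Y)) e) (D (tens c L (tens c X Y)) e)"
      by (rule D_cong[OF c_VF[OF X LY] e c_left_commute[OF X L Y] eq_on_refl])
    then have "eq_on U (D (tens c X (tens c L Y)) e) (D (tens c X Y) (tens c L e))"
      by (rule eq_on_trans[OF _ eq_on_sym[OF D_L_unit[OF XY]]])
    then have "eq_on U (vminus (D X (tens c L Y)) (D (tens c X (tens c L Y)) e))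
        (vminus (D X (tens c L Y)) (D (tens c X Y) (tens c L e)))"
      by (intro vadd_cong vscale_cong eq_on_refl)
    then show "eq_on U (conj_L N X Y) (vminus (conj_L D X Y) (conj_L D (tens c X Y) e))"
      unfolding conj_L_def
      by (rule eq_on_trans[OF c_field_cong[OF eq_on_trans[OF N'[OF X LY]]]
            c_field_vminus[OF K D_VF[OF X LY] D_VF[OF XY c_VF[OF L e]]]])
  qed
qed

lemma conj_L_riemann:
  assumes X: "VF U X" and Y: "VF U Y" and Z: "VF U Z"
  shows "eq_on U (riemann_tensor M A (conj_L D) X Y Z) (tens c K (riemann_tensor M A D X Y (tens c L Z)))"
proof -
  note L = L_VF[OF X] and K = K_VF[OF X] and B = bracket_VF[OF X Y]
  note LZ = c_VF[OF L Z]
  have second: "eq_on U (conj_L D P (conj_L D Q Z)) (tens c K (D P (D Q (tens c L Z))))"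
    if P: "VF U P" and Q: "VF U Q" for P Q
    unfolding conj_L_def
    by (intro c_field_cong D_cong[OF P c_VF[OF L c_VF[OF K D_VF[OF Q LZ]]] eq_on_refl
          L_K_field[OF D_VF[OF Q LZ]]])
  note XY = D_VF[OF X D_VF[OF Y LZ]] and YX = D_VF[OF Y D_VF[OF X LZ]] and BZ = D_VF[OF B LZ]
  have "eq_on U (riemann_tensor M A (conj_L D) X Y Z)
      (vminus (vminus (tens c K (D X (D Y (tens c L Z)))) (tens c K (D Y (D X (tens c L Z)))))
        (tens c K (D (bracket X Y) (tens c L Z))))"
    unfolding riemann_tensor_def
    using eq_on_refl[of U "conj_L D (bracket X Y) Z"]
    by (intro vadd_cong vscale_cong second X Y) (simp only: conj_L_def)
  moreover have "eq_on U (tens c K (riemann_tensor M A D X Y (tens c L Z)))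
      (vminus (vminus (tens c K (D X (D Y (tens c L Z)))) (tens c K (D Y (D X (tens c L Z)))))
        (tens c K (D (bracket X Y) (tens c L Z))))"
    unfolding riemann_tensor_def
    by (rule eq_on_trans[OF c_field_vminus[OF K VF_vminus[OF XY YX] BZ]
          vadd_cong[OF c_field_vminus[OF K XY YX] eq_on_refl]])
  ultimately show ?thesis by (rule eq_on_trans[OF _ eq_on_sym])
qed

text \<open>Curvature is conjugated by \<open>L\<close> as well, and the identity for \<open>W\<close> in the new metric is the
  original identity for \<open>L \<circ> W\<close>, multiplied by \<open>L\<^sup>-\<^sup>1\<close>.\<close>

lemma conj_L_curvature_identity:
  assumes R: "\<And>U X Y Z W. VF U X \<Longrightarrow> VF U Y \<Longrightarrow> VF U Z \<Longrightarrow> VF U W \<Longrightarrow>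
      eq_on U (vadd (vadd (riemann_tensor M A D Y Z (tens c X W)) (riemann_tensor M A D X Y (tens c Z W)))
          (riemann_tensor M A D Z X (tens c Y W))) (\<lambda>p. tzero)"
    and X: "VF U X" and Y: "VF U Y" and Z: "VF U Z" and W: "VF U W"
  shows "eq_on U (vadd (vadd (riemann_tensor M A (conj_L D) Y Z (tens c X W))
      (riemann_tensor M A (conj_L D) X Y (tens c Z W)))
          (riemann_tensor M A (conj_L D) Z X (tens c Y W))) (\<lambda>p. tzero)"
proof -
  note L = L_VF[OF X] and K = K_VF[OF X]
  note LW = c_VF[OF L W]
  let ?R = "\<lambda>P Q S. riemann_tensor M A D P Q (tens c S (tens c L W))"
  have summand: "eq_on U (riemann_tensor M A (conj_L D) P Q (tens c S W)) (tens c K (?R P Q S))"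
    if P: "VF U P" and Q: "VF U Q" and S: "VF U S" for P Q S
    by (rule eq_on_trans[OF conj_L_riemann[OF P Q c_VF[OF S W]]
          c_field_cong[OF riemann_cong[OF P Q c_VF[OF L c_VF[OF S W]] c_left_commute[OF L S W]]]])
  have RV: "VF U (?R P Q S)" if P: "VF U P" and Q: "VF U Q" and S: "VF U S" for P Q S
    by (rule riemann_VF[OF P Q c_VF[OF S LW]])
  have "eq_on U (tens c K (vadd (vadd (?R Y Z X) (?R X Y Z)) (?R Z X Y)))
      (vadd (vadd (tens c K (?R Y Z X)) (tens c K (?R X Y Z))) (tens c K (?R Z X Y)))"
    by (rule eq_on_trans[OF c_field_vadd[OF K VF_vadd[OF RV[OF Y Z X] RV[OF X Y Z]] RV[OF Z X Y]]
          vadd_cong[OF c_field_vadd[OF K RV[OF Y Z X] RV[OF X Y Z]] eq_on_refl]])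
  then have "eq_on U (vadd (vadd (riemann_tensor M A (conj_L D) Y Z (tens c X W))
      (riemann_tensor M A (conj_L D) X Y (tens c Z W))) (riemann_tensor M A (conj_L D) Z X (tens c Y W)))
      (tens c K (vadd (vadd (?R Y Z X) (?R X Y Z)) (?R Z X Y)))"
    by (rule eq_on_trans[OF vadd_cong[OF vadd_cong[OF summand[OF Y Z X] summand[OF X Y Z]]
            summand[OF Z X Y]] eq_on_sym])
  note trans1 = eq_on_trans[OF this]
  \<comment> \<open>As a multiple of a field, the zero field is mapped to itself by linearity of the product.\<close>
  have "eq_on U (tens c K (vadd (vadd (?R Y Z X) (?R X Y Z)) (?R Z X Y))) (tens c K (vscale (\<lambda>p. 0) K))"
  proof (rule c_field_cong)
    have "vscale (\<lambda>p. 0) K = (\<lambda>p. tzero)" by (simp add: vscale_def tscale_def)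
    then show "eq_on U (vadd (vadd (?R Y Z X) (?R X Y Z)) (?R Z X Y)) (vscale (\<lambda>p. 0) K)"
      using R[OF X Y Z LW] by simp
  qed
  note trans2 = eq_on_trans[OF this]
  have "eq_on U (tens c K (vscale (\<lambda>p. 0) K)) (\<lambda>p. tzero)"
  proof -
    have "vscale (\<lambda>p. 0) (tens c K K) = (\<lambda>p. tzero)" by (simp add: vscale_def tscale_def)
    then show ?thesis using c_field_vscale[OF K K, of "\<lambda>p. 0"] by simp
  qed
  then show ?thesis by (rule trans1[OF trans2])
qed

end

section \<open>Metrics from flat Legendre fields\<close>

theorem theorem6p5:
  fixes M :: "'a topology" and A :: "('a, 'e::euclidean_space) chart set"
    and c :: "'a prod_field" and g :: "'a metric_field" and e :: "'a vfield"
    and nabla :: "'a conn" and X Xinv :: "'a vfield"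
  assumes "smooth_manifold M A"
    and "riemannian_F_manifold_killing M A c g e"
    and "associated_flat_connection M A c g e nabla"
    and "legendre_field M A c e nabla X"
    and "flat_field M A nabla X"
    and "inverse_field M A c e X Xinv"
  shows "let gbar = (\<lambda>p u v. g p (c p (X p) u) (c p (X p) v));
             nablabar = (\<lambda>Y Z. tens c Xinv (nabla Y (tens c X Z)))
         in riemannian_F_manifold_killing M A c gbar e \<and>
            associated_flat_connection M A c gbar e nablabar"
proof -
  obtain D where F: "F_manifold M A c e" and metric: "pseudo_riemannian_metric M A g"
    and inv: "\<forall>U X Y Z. vector_field M A U X \<and> vector_field M A U Y \<and> vector_field M A U Z \<longrightarrow>
        (\<forall>p\<in>U. tens g (tens c X Y) Z p = tens g X (tens c Y Z) p)"
    and D: "levi_civita M A g D"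
    and R: "\<forall>U X Y Z W. vector_field M A U X \<and> vector_field M A U Y \<and> vector_field M A U Z \<and> vector_field M A U W \<longrightarrow>
           eq_on U
             (vadd (vadd (riemann_tensor M A D Y Z (tens c X W)) (riemann_tensor M A D X Y (tens c Z W)))
                   (riemann_tensor M A D Z X (tens c Y W)))
             (\<lambda>p. tzero)"
    and killing: "killing M A g e"
    using assms(2) unfolding riemannian_F_manifold_killing_def by (elim conjE exE)
  interpret killing_F_manifold M A g D c e
    by unfold_locales (use assms(1) F metric inv D killing in simp_all)
  have conn: "connection M A nabla"
    using assms(3) by (simp add: associated_flat_connection_def)
  have X: "VF (topspace M) X"
    using assms(4) by (simp add: legendre_field_def)
  have Xinv: "VF (topspace M) Xinv" "eq_on (topspace M) (tens c X Xinv) e"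
    using assms(6) by (simp_all add: inverse_field_def)
  interpret flat_multiplier M A g D c e X Xinv
  proof unfold_locales
    show "VF (topspace M) X" "VF (topspace M) Xinv" "eq_on (topspace M) (tens c X Xinv) e"
      by (fact X Xinv)+
    fix U Y assume Y: "VF U Y"
    note XU = VF_restrict[OF X Y]
    have "eq_on U (nabla Y X) (\<lambda>p. tzero)"
      using assms(5) Y by (simp add: flat_field_def)
    moreover have "eq_on U (nabla Y X) (vminus (D Y X) (D (tens c Y X) e))"
      using assms(3) Y XU unfolding associated_flat_connection_iff[OF conn] by simp
    ultimately have "eq_on U (D Y X) (D (tens c Y X) e)"
      by (simp add: eq_on_def vadd_def vscale_def tadd_def tscale_def fun_eq_iff)
    moreover have "eq_on U (D (tens c Y X) e) (D (tens c X Y) e)"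
      by (rule D_cong[OF c_VF[OF Y XU] e_VF[OF Y] c_field_commute[OF Y XU] eq_on_refl])
    ultimately show "eq_on U (D Y X) (D (tens c X Y) e)" by (rule eq_on_trans)
  qed
  have "riemannian_F_manifold_killing M A c gL e"
    unfolding riemannian_F_manifold_killing_def
  proof (intro conjI exI[of _ "conj_L D"] allI impI ballI; (elim conjE)?)
    show "F_manifold M A c e" by (rule F)
    show "pseudo_riemannian_metric M A gL" by (rule gL_metric)
    show "levi_civita M A gL (conj_L D)" by (rule conj_L_levi_civita)
    show "killing M A gL e" by (rule gL_killing)
    show "tens gL (tens c P Q) S p = tens gL P (tens c Q S) p"
      if "VF U P" "VF U Q" "VF U S" "p \<in> U" for U P Q S p
      by (rule L.invariant[OF that])
    show "eq_on U (vadd (vadd (riemann_tensor M A (conj_L D) Q S (tens c P W))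
        (riemann_tensor M A (conj_L D) P Q (tens c S W))) (riemann_tensor M A (conj_L D) S P (tens c Q W)))
        (\<lambda>p. tzero)" if "VF U P" "VF U Q" "VF U S" "VF U W" for U P Q S W
      by (rule conj_L_curvature_identity[OF _ that]) (use R in simp)
  qed
  then show ?thesis
    unfolding Let_def using conj_L_associated[OF assms(3)] unfolding conj_L_def by (rule conjI)
qed

end
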